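(* There is a universal constant $C>0$ such that the following holds. Let $\hat x_0\in\operatorname{dom} h$ and $\bar\varepsilon>0$, and let $\lambda>0$ satisfy $$\frac{\sqrt{\bar\varepsilon d_0}}{M^{3/2}}\le\lambda\le\frac{2d_0^2}{\bar\varepsilon}.$$ Run PDPB$(\hat x_0,\lambda,\bar\varepsilon)$, with $\tau_j=j/(j+2)$ for all $j\ge1$ in every call to PDCP. Then the total number of PDCP iterations (summed over all calls to PDCP) performed until a pair $(\bar x_k,\bar s_k)$ satisfying $$\hat\phi(\bar x_k)+f^*(\bar s_k)+\hat h^*(-\bar s_k)\le 10\,\bar\varepsilon$$ is obtained is at most $C\left(\dfrac{M^2d_0^2}{\bar\varepsilon^2}+1\right)$.
   Context: Problem. $f,h:\mathbb R^n\to\mathbb R\cup\{+\infty\}$ are proper lower semicontinuous convex functions with $\operatorname{dom}h\subset\operatorname{dom}f$, and $\phi=f+h$. Assumptions: there is a map $f':\operatorname{dom}h\to\mathbb R^n$ with $f'(x)\in\partial f(x)$ for all $x\in\operatorname{dom}h$; $\|f'(x)\|\le M$ for all $x\in\operatorname{dom}h$, for some $M>0$; the set $X_*$ of minimizers of $\phi$ is nonempty. Write $\ell_f(u;y)=f(y)+\langle f'(y),u-y\rangle$; $g^*$ denotes the convex conjugate of $g$. For $\hat x_0\in\operatorname{dom}h$ let $d_0=\min\{\|x_*-\hat x_0\|:x_*\in X_*\}$. Let $Q=B(\hat x_0,6d_0)$ be the closed ball, $I_Q$ its indicator function, $\hat h=h+I_Q$, $\hat\phi=f+\hat h$. PDCP$(x_0,\lambda,\varepsilon)$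 (primal-dual cutting-plane), with $x_0\in\operatorname{dom}h$, $\lambda,\varepsilon>0$. Let $h^\lambda(u)=h(u)+\frac1{2\lambda}\|u-x_0\|^2$ and $\phi^\lambda=f+h^\lambda$. Start with $\Gamma_1=\ell_f(\cdot;x_0)$. For $j=1,2,\dots$: (i) $x_j=\operatorname{argmin}_u\{\Gamma_j(u)+h^\lambda(u)\}$, $m_j=\min_u\{\Gamma_j(u)+h^\lambda(u)\}$, and $s_j\in\partial\Gamma_j(x_j)\cap(-\partial h^\lambda(x_j))$; (ii) a point $\tilde x_j$ is chosen with $\tilde x_1=x_1$ and $\phi^\lambda(\tilde x_j)\le\tau_{j-1}\phi^\lambda(\tilde x_{j-1})+(1-\tau_{j-1})\phi^\lambda(x_j)$ for $j\ge2$; $t_j=\phi^\lambda(\tilde x_j)-m_j$; (iii) $\tau_j\in[0,1]$ is selected, and $\Gamma_{j+1}$ is any proper lower semicontinuous convex function with $\Gamma_{j+1}\le f$ and $\Gamma_{j+1}\ge\tau_j\bar\Gamma_j+(1-\tau_j)\ell_f(\cdot;x_j)$, for some proper lower semicontinuous convex $\bar\Gamma_j\le f$ with $\bar\Gamma_j(x_j)=\Gamma_j(x_j)$ and $x_j=\operatorname{argmin}_u\{\bar\Gamma_j(u)+h^\lambda(u)\}$. PDCP stops at the first $j$ with $t_j\le\varepsilon$ and returns $(x_j,\tilde x_j,s_j)$. PDPB$(\hat x_0,\lambda,\bar\varepsilon)$ (primal-dual proximal bundle): for $k=1,2,\dots$, set $(\hat x_k,\tilde x_k,s_k)=\text{PDCP}(\hat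 x_{k-1},\lambda,\bar\varepsilon)$ and $\bar x_k=\frac1k\sum_{i=1}^k\tilde x_i$, $\bar s_k=\frac1k\sum_{i=1}^ks_i$ (here $\tilde x_i,s_i$ denote the outputs of the $i$-th call). *)

theory Defs
  imports "HOL-Analysis.Analysis"
begin

section \<open>All Euclidean spaces inside one type\<close>

text \<open>
  The constant in the theorem must not depend on the dimension, so the dimension has to be
  quantified inside the formula and cannot be a type. We use the inner product space of finitely
  supported real sequences: \<open>Rn n\<close>, the sequences that vanish from index \<open>n\<close> on, is
  $n$-dimensional Euclidean space with its usual inner product, norm and topology.
\<close>

typedef fsseq = "{x :: nat \<Rightarrow> real. finite {i. x i \<noteq> 0}}"
  morphisms coord Abs_fsseq
  by (rule exI[of _ "\<lambda>_. 0"]) simp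

setup_lifting type_definition_fsseq

instantiation fsseq :: real_vector
begin

lift_definition zero_fsseq :: fsseq is "\<lambda>_. 0" by simp

lift_definition plus_fsseq :: "fsseq \<Rightarrow> fsseq \<Rightarrow> fsseq" is "\<lambda>x y i. x i + y i"
  subgoal for x y
    by (rule finite_subset[of _ "{i. x i \<noteq> 0} \<union> {i. y i \<noteq> 0}"]) auto
  done

lift_definition minus_fsseq :: "fsseq \<Rightarrow> fsseq \<Rightarrow> fsseq" is "\<lambda>x y i. x i - y i"
  subgoal for x y
    by (rule finite_subset[of _ "{i. x i \<noteq> 0} \<union> {i. y i \<noteq> 0}"]) auto
  done

lift_definition uminus_fsseq :: "fsseq \<Rightarrow> fsseq" is "\<lambda>x i. - x i" by simp

lift_definition scaleR_fsseq :: "real \<Rightarrow> fsseq \<Rightarrow> fsseq" is "\<lambda>r x i. r * x i"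
  subgoal for r x
    by (rule finite_subset[of _ "{i. x i \<noteq> 0}"]) auto
  done

instance
  by standard (transfer; simp add: algebra_simps fun_eq_iff)+

end

lemma finite_coord_support [simp]: "finite {i. coord x i \<noteq> 0}"
  using coord[of x] by simp

instantiation fsseq :: real_inner
begin

definition inner_fsseq :: "fsseq \<Rightarrow> fsseq \<Rightarrow> real" where
  "inner_fsseq x y = (\<Sum>i | coord x i \<noteq> 0. coord x i * coord y i)"

definition norm_fsseq :: "fsseq \<Rightarrow> real" where
  "norm_fsseq x = sqrt (inner x x)"

definition sgn_fsseq :: "fsseq \<Rightarrow> fsseq" where
  "sgn_fsseq x = inverse (norm x) *\<^sub>R x"

definition dist_fsseq :: "fsseq \<Rightarrow> fsseq \<Rightarrow> real" where
  "dist_fsseq x y = norm (x - y)"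

definition uniformity_fsseq :: "(fsseq \<times> fsseq) filter" where
  "uniformity_fsseq = (INF e\<in>{0<..}. principal {(x, y). dist x y < e})"

definition open_fsseq :: "fsseq set \<Rightarrow> bool" where
  "open_fsseq U \<longleftrightarrow> (\<forall>x\<in>U. eventually (\<lambda>(x', y). x' = x \<longrightarrow> y \<in> U) uniformity)"

lemma inner_fsseq_superset:
  assumes "finite A" "{i. coord x i \<noteq> 0} \<subseteq> A"
  shows "inner x y = (\<Sum>i\<in>A. coord x i * coord y i)"
  unfolding inner_fsseq_def using assms by (intro sum.mono_neutral_left) auto

instance
proof
  fix x y z :: fsseq and r :: real
  let ?A = "{i. coord x i \<noteq> 0} \<union> {i. coord y i \<noteq> 0}"
  have fin: "finite ?A" by simp
  have A: "inner x w = (\<Sum>i\<in>?A. coord x i * coord w i)"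
    "inner y w = (\<Sum>i\<in>?A. coord y i * coord w i)" for w
    by (rule inner_fsseq_superset; auto)+
  show "inner x y = inner y x"
    by (simp add: A mult.commute)
  have "inner (x + y) z = (\<Sum>i\<in>?A. coord (x + y) i * coord z i)"
    by (rule inner_fsseq_superset) (auto simp: plus_fsseq.rep_eq)
  then show "inner (x + y) z = inner x z + inner y z"
    by (simp add: A plus_fsseq.rep_eq algebra_simps sum.distrib)
  have "inner (r *\<^sub>R x) y = (\<Sum>i\<in>?A. coord (r *\<^sub>R x) i * coord y i)"
    by (rule inner_fsseq_superset) (auto simp: scaleR_fsseq.rep_eq)
  then show "inner (r *\<^sub>R x) y = r * inner x y"
    by (simp add: A scaleR_fsseq.rep_eq sum_distrib_left mult.assoc)
  show "0 \<le> inner x x"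
    by (simp add: inner_fsseq_def sum_nonneg)
  have "inner x x = 0 \<longleftrightarrow> (\<forall>i. coord x i = 0)"
    unfolding inner_fsseq_def by (subst sum_nonneg_eq_0_iff) auto
  also have "\<dots> \<longleftrightarrow> x = 0"
    by (simp add: coord_inject[symmetric] zero_fsseq.rep_eq fun_eq_iff)
  finally show "inner x x = 0 \<longleftrightarrow> x = 0" .
qed (fact sgn_fsseq_def dist_fsseq_def uniformity_fsseq_def open_fsseq_def norm_fsseq_def)+

end

definition Rn :: "nat \<Rightarrow> fsseq set" where
  "Rn n = {x. \<forall>i\<ge>n. coord x i = 0}"

lemma subspace_Rn: "subspace (Rn n)"
  by (auto simp: subspace_def Rn_def zero_fsseq.rep_eq plus_fsseq.rep_eq scaleR_fsseq.rep_eq)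

lemma inner_Rn:
  assumes "x \<in> Rn n"
  shows "inner x y = (\<Sum>i<n. coord x i * coord y i)"
  using assms by (intro inner_fsseq_superset) (auto simp: Rn_def not_le[symmetric])


section \<open>Extended-valued convex functions\<close>

text \<open>
  In what follows \<open>V\<close> is the space on which the functions live (\<open>Rn n\<close> in the theorem); their
  values outside \<open>V\<close> play no role. Sums of extended reals are only formed where no summand is
  \<open>-\<infinity>\<close>, and the convention \<open>0 * \<infinity> = 0\<close> is that of convex analysis.
\<close>

definition edom :: "'a set \<Rightarrow> ('a \<Rightarrow> ereal) \<Rightarrow> 'a set" where
  "edom V g = {x \<in> V. g x < \<infinity>}"

definition proper_fun :: "'a set \<Rightarrow> ('a \<Rightarrow> ereal) \<Rightarrow> bool" where
  "proper_fun V g \<longleftrightarrow> (\<forall>x\<in>V. g x \<noteq> -\<infinity>) \<and> edom V g \<noteq> {}"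

definition lsc_fun :: "'a::topological_space set \<Rightarrow> ('a \<Rightarrow> ereal) \<Rightarrow> bool" where
  "lsc_fun V g \<longleftrightarrow> (\<forall>x\<in>V. g x \<le> Liminf (at x within V) g)"

definition convex_fun :: "'a::real_vector set \<Rightarrow> ('a \<Rightarrow> ereal) \<Rightarrow> bool" where
  "convex_fun V g \<longleftrightarrow>
    (\<forall>x\<in>V. \<forall>y\<in>V. \<forall>t\<in>{0<..<1}.
       g ((1 - t) *\<^sub>R x + t *\<^sub>R y) \<le> ereal (1 - t) * g x + ereal t * g y)"

definition plc_fun :: "'a::real_normed_vector set \<Rightarrow> ('a \<Rightarrow> ereal) \<Rightarrow> bool" where
  "plc_fun V g \<longleftrightarrow> proper_fun V g \<and> lsc_fun V g \<and> convex_fun V g"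

definition subdiff :: "'a::real_inner set \<Rightarrow> ('a \<Rightarrow> ereal) \<Rightarrow> 'a \<Rightarrow> 'a set" where
  "subdiff V g x = {s \<in> V. \<forall>u\<in>V. g x + ereal (inner s (u - x)) \<le> g u}"

definition conjugate :: "'a::real_inner set \<Rightarrow> ('a \<Rightarrow> ereal) \<Rightarrow> 'a \<Rightarrow> ereal" where
  "conjugate V g s = (SUP u\<in>V. ereal (inner s u) - g u)"

definition indicator_fun :: "'a set \<Rightarrow> 'a \<Rightarrow> ereal" where
  "indicator_fun Q u = (if u \<in> Q then 0 else \<infinity>)"


section \<open>The problem\<close>

definition minimizers :: "'a set \<Rightarrow> ('a \<Rightarrow> ereal) \<Rightarrow> 'a set" where
  "minimizers V g = {x. is_arg_min g (\<lambda>u. u \<in> V) x}"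

definition problem ::
  "'a::real_inner set \<Rightarrow> ('a \<Rightarrow> ereal) \<Rightarrow> ('a \<Rightarrow> ereal) \<Rightarrow> ('a \<Rightarrow> 'a) \<Rightarrow> real \<Rightarrow> bool" where
  "problem V f h f' M \<longleftrightarrow>
    plc_fun V f \<and> plc_fun V h \<and> edom V h \<subseteq> edom V f \<and>
    (\<forall>x\<in>edom V h. f' x \<in> subdiff V f x) \<and>
    M > 0 \<and> (\<forall>x\<in>edom V h. norm (f' x) \<le> M) \<and>
    minimizers V (\<lambda>u. f u + h u) \<noteq> {}"

definition sol_dist ::
  "'a::real_inner set \<Rightarrow> ('a \<Rightarrow> ereal) \<Rightarrow> ('a \<Rightarrow> ereal) \<Rightarrow> 'a \<Rightarrow> real" where
  "sol_dist V f h c = Inf ((\<lambda>x. norm (x - c)) ` minimizers V (\<lambda>u. f u + h u))"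

definition linearization ::
  "('a::real_inner \<Rightarrow> ereal) \<Rightarrow> ('a \<Rightarrow> 'a) \<Rightarrow> 'a \<Rightarrow> 'a \<Rightarrow> ereal" where
  "linearization f f' y u = f y + ereal (inner (f' y) (u - y))"


section \<open>The primal-dual cutting-plane method\<close>

text \<open>
  \<open>c\<close> is the prox center (the point $x_0$ passed to the method); \<open>G\<close>, \<open>x\<close>, \<open>y\<close>, \<open>s\<close> are the
  sequences $\Gamma_j$, $x_j$, $\tilde x_j$, $s_j$, indexed from 1.
\<close>

definition prox_reg :: "('a::real_normed_vector \<Rightarrow> ereal) \<Rightarrow> real \<Rightarrow> 'a \<Rightarrow> 'a \<Rightarrow> ereal" where
  "prox_reg h lam c u = h u + ereal (1 / (2 * lam) * (norm (u - c))\<^sup>2)"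

definition pdcp_gap ::
  "'a::real_inner set \<Rightarrow> ('a \<Rightarrow> ereal) \<Rightarrow> ('a \<Rightarrow> ereal) \<Rightarrow> real \<Rightarrow> 'a \<Rightarrow>
   (nat \<Rightarrow> 'a \<Rightarrow> ereal) \<Rightarrow> (nat \<Rightarrow> 'a) \<Rightarrow> nat \<Rightarrow> ereal" where
  "pdcp_gap V f h lam c G y j =
    (f (y j) + prox_reg h lam c (y j)) - (INF u\<in>V. G j u + prox_reg h lam c u)"

definition pdcp_stops ::
  "'a::real_inner set \<Rightarrow> ('a \<Rightarrow> ereal) \<Rightarrow> ('a \<Rightarrow> ereal) \<Rightarrow> real \<Rightarrow> real \<Rightarrow> 'a \<Rightarrow>
   (nat \<Rightarrow> 'a \<Rightarrow> ereal) \<Rightarrow> (nat \<Rightarrow> 'a) \<Rightarrow> bool" where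
  "pdcp_stops V f h lam eps c G y \<longleftrightarrow> (\<exists>j\<ge>1. pdcp_gap V f h lam c G y j \<le> ereal eps)"

text \<open>The number of iterations performed; meaningful only if the method stops.\<close>

definition pdcp_iters ::
  "'a::real_inner set \<Rightarrow> ('a \<Rightarrow> ereal) \<Rightarrow> ('a \<Rightarrow> ereal) \<Rightarrow> real \<Rightarrow> real \<Rightarrow> 'a \<Rightarrow>
   (nat \<Rightarrow> 'a \<Rightarrow> ereal) \<Rightarrow> (nat \<Rightarrow> 'a) \<Rightarrow> nat" where
  "pdcp_iters V f h lam eps c G y =
    (LEAST j. j \<ge> 1 \<and> pdcp_gap V f h lam c G y j \<le> ereal eps)"

text \<open>Iteration \<open>j\<close> is carried out: the stopping test has failed at all earlier iterations.\<close>

definition pdcp_active ::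
  "'a::real_inner set \<Rightarrow> ('a \<Rightarrow> ereal) \<Rightarrow> ('a \<Rightarrow> ereal) \<Rightarrow> real \<Rightarrow> real \<Rightarrow> 'a \<Rightarrow>
   (nat \<Rightarrow> 'a \<Rightarrow> ereal) \<Rightarrow> (nat \<Rightarrow> 'a) \<Rightarrow> nat \<Rightarrow> bool" where
  "pdcp_active V f h lam eps c G y j \<longleftrightarrow>
    j \<ge> 1 \<and> (\<forall>i\<in>{1..<j}. \<not> pdcp_gap V f h lam c G y i \<le> ereal eps)"

text \<open>\<open>Gnew\<close> is an admissible model following \<open>Gold\<close>, where \<open>z\<close> is the current iterate.\<close>

definition model_update ::
  "'a::real_inner set \<Rightarrow> ('a \<Rightarrow> ereal) \<Rightarrow> ('a \<Rightarrow> ereal) \<Rightarrow> ('a \<Rightarrow> 'a) \<Rightarrow> real \<Rightarrow> 'a \<Rightarrow>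
   real \<Rightarrow> 'a \<Rightarrow> ('a \<Rightarrow> ereal) \<Rightarrow> ('a \<Rightarrow> ereal) \<Rightarrow> bool" where
  "model_update V f h f' lam c t z Gold Gnew \<longleftrightarrow>
    plc_fun V Gnew \<and> (\<forall>u\<in>V. Gnew u \<le> f u) \<and>
    (\<exists>B. plc_fun V B \<and> (\<forall>u\<in>V. B u \<le> f u) \<and> B z = Gold z \<and>
         is_arg_min (\<lambda>u. B u + prox_reg h lam c u) (\<lambda>u. u \<in> V) z \<and>
         (\<forall>u\<in>V. ereal t * B u + ereal (1 - t) * linearization f f' z u \<le> Gnew u))"

text \<open>
  Nothing is required of the sequences beyond the iteration at which the method stops.
\<close>

definition pdcp_run ::
  "'a::real_inner set \<Rightarrow> ('a \<Rightarrow> ereal) \<Rightarrow> ('a \<Rightarrow> ereal) \<Rightarrow> ('a \<Rightarrow> 'a) \<Rightarrow> real \<Rightarrow> real \<Rightarrow>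
   'a \<Rightarrow> (nat \<Rightarrow> real) \<Rightarrow>
   (nat \<Rightarrow> 'a \<Rightarrow> ereal) \<Rightarrow> (nat \<Rightarrow> 'a) \<Rightarrow> (nat \<Rightarrow> 'a) \<Rightarrow> (nat \<Rightarrow> 'a) \<Rightarrow> bool" where
  "pdcp_run V f h f' lam eps c tau G x y s \<longleftrightarrow>
    (\<forall>u\<in>V. G 1 u = linearization f f' c u) \<and>
    (\<forall>j. pdcp_active V f h lam eps c G y j \<longrightarrow>
       is_arg_min (\<lambda>u. G j u + prox_reg h lam c u) (\<lambda>u. u \<in> V) (x j) \<and>
       s j \<in> subdiff V (G j) (x j) \<inter> uminus ` subdiff V (prox_reg h lam c) (x j) \<and>
       y j \<in> V \<and>
       (j = 1 \<longrightarrow> y j = x j) \<and>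
       (j \<ge> 2 \<longrightarrow>
          f (y j) + prox_reg h lam c (y j)
          \<le> ereal (tau (j - 1)) * (f (y (j - 1)) + prox_reg h lam c (y (j - 1)))
            + ereal (1 - tau (j - 1)) * (f (x j) + prox_reg h lam c (x j)))) \<and>
    (\<forall>j\<ge>1. pdcp_active V f h lam eps c G y (j + 1) \<longrightarrow>
       tau j \<in> {0..1} \<and> model_update V f h f' lam c (tau j) (x j) (G j) (G (j + 1)))"


section \<open>The primal-dual proximal bundle method\<close>

text \<open>
  The first index of \<open>tau\<close>, \<open>G\<close>, \<open>x\<close>, \<open>y\<close>, \<open>s\<close> is the number \<open>k\<close> of the call to PDCP;
  \<open>c (k - 1)\<close> is the prox center of call \<open>k\<close>, so \<open>c k\<close> is the point $\hat x_k$. The \<open>k\<close>-th call is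
  only constrained if all earlier calls stop.
\<close>

definition pdpb_run ::
  "'a::real_inner set \<Rightarrow> ('a \<Rightarrow> ereal) \<Rightarrow> ('a \<Rightarrow> ereal) \<Rightarrow> ('a \<Rightarrow> 'a) \<Rightarrow> real \<Rightarrow> real \<Rightarrow>
   'a \<Rightarrow> (nat \<Rightarrow> nat \<Rightarrow> real) \<Rightarrow> (nat \<Rightarrow> 'a) \<Rightarrow>
   (nat \<Rightarrow> nat \<Rightarrow> 'a \<Rightarrow> ereal) \<Rightarrow> (nat \<Rightarrow> nat \<Rightarrow> 'a) \<Rightarrow> (nat \<Rightarrow> nat \<Rightarrow> 'a) \<Rightarrow>
   (nat \<Rightarrow> nat \<Rightarrow> 'a) \<Rightarrow> bool" where
  "pdpb_run V f h f' lam eps x0 tau c G x y s \<longleftrightarrow>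
    c 0 = x0 \<and>
    (\<forall>k\<ge>1. (\<forall>i\<in>{1..<k}. pdcp_stops V f h lam eps (c (i - 1)) (G i) (y i)) \<longrightarrow>
       pdcp_run V f h f' lam eps (c (k - 1)) (tau k) (G k) (x k) (y k) (s k) \<and>
       (pdcp_stops V f h lam eps (c (k - 1)) (G k) (y k) \<longrightarrow>
          c k = x k (pdcp_iters V f h lam eps (c (k - 1)) (G k) (y k))))"

definition pdpb_iters ::
  "'a::real_inner set \<Rightarrow> ('a \<Rightarrow> ereal) \<Rightarrow> ('a \<Rightarrow> ereal) \<Rightarrow> real \<Rightarrow> real \<Rightarrow> (nat \<Rightarrow> 'a) \<Rightarrow>
   (nat \<Rightarrow> nat \<Rightarrow> 'a \<Rightarrow> ereal) \<Rightarrow> (nat \<Rightarrow> nat \<Rightarrow> 'a) \<Rightarrow> nat \<Rightarrow> nat" where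
  "pdpb_iters V f h lam eps c G y k = pdcp_iters V f h lam eps (c (k - 1)) (G k) (y k)"

text \<open>
  The average of the outputs of the first \<open>k\<close> calls; \<open>J i\<close> is the last iteration of call \<open>i\<close>.
\<close>

definition output_avg :: "(nat \<Rightarrow> nat) \<Rightarrow> (nat \<Rightarrow> nat \<Rightarrow> 'a::real_vector) \<Rightarrow> nat \<Rightarrow> 'a" where
  "output_avg J z k = (1 / real k) *\<^sub>R (\<Sum>i=1..k. z i (J i))"

definition pd_gap ::
  "'a::real_inner set \<Rightarrow> ('a \<Rightarrow> ereal) \<Rightarrow> ('a \<Rightarrow> ereal) \<Rightarrow> 'a set \<Rightarrow> 'a \<Rightarrow> 'a \<Rightarrow> ereal" where
  "pd_gap V f h Q p q =
    (let hQ = (\<lambda>u. h u + indicator_fun Q u)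
     in (f p + hQ p) + conjugate V f q + conjugate V hQ (- q))"

end

theory Submission
  imports Defs
begin

text \<open>
  The bound is (number of calls) times (iterations per call). Write \<open>w\<^sup>2 = M * d0 / eps\<close>, so that the
  claimed bound has order \<open>w ^ 4 + 1\<close>.

  Iterations per call. Let \<open>t j\<close> be the gap between the regularized objective at the \<open>j\<close>-th point
  \<open>y j\<close> and the minimum \<open>m j\<close> of the regularized model. Two facts drive the recursion: the
  regularized objective is strongly convex, and linearizing \<open>f\<close> costs only
  \<open>2 * M * norm (u - v)\<close>. Since \<open>tau j = j / (j + 2)\<close>, they give \<open>gap_step\<close>, which telescopes after
  multiplication by \<open>(j + 1) * (j + 2)\<close> (\<open>gap_recursion_bound\<close>) to
  \<open>t j = O (t 1 / j\<^sup>2 + lam * M\<^sup>2 / j)\<close>. The first gap is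
  \<open>O (lam * M\<^sup>2 + M * R)\<close>, where \<open>R\<close> bounds the distance from the center to a minimizer (\<open>first_gap\<close>).
  Hence a call stops within \<open>O (sqrt (M * R / eps) + lam * M\<^sup>2 / eps + 1)\<close> iterations
  (\<open>stops_within\<close>).

  Number of calls. What a call returns is an approximate proximal step (\<open>approx_prox_step\<close>):
  its data contain an affine minorant of \<open>f\<close> with slope \<open>s\<close> and a strongly convex lower bound for
  \<open>h\<close> plus the quadratic with slope \<open>-s\<close>, which together match the primal value up to \<open>eps\<close>. The minorants bound
  both conjugates, and summing them over the calls makes the quadratic terms telescope; after \<open>k\<close>
  calls the primal-dual gap over a ball of radius \<open>6 * d0\<close> is at most
  \<open>eps + 18 * d0\<^sup>2 / (lam * k)\<close> (\<open>prox_chain_gap\<close>), so about \<open>2 * d0\<^sup>2 / (lam * eps)\<close> calls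
  suffice. During these calls the squared distance to a minimizer grows by at most \<open>2 * lam * eps\<close>
  per call, so the centers stay within about \<open>3 * d0\<close> of a minimizer and the primal outputs, hence
  their averages, inside the ball (\<open>prox_chain_in_ball\<close>); in particular \<open>R = 4 * d0\<close> is admissible in every call.

  The product. The upper bound on \<open>lam\<close> makes the number of calls \<open>O (d0\<^sup>2 / (lam * eps))\<close>, and the
  lower bound on \<open>lam\<close> makes this \<open>O (w ^ 3)\<close>. The three terms of the per-call bound then
  contribute \<open>w ^ 3 * w\<close>, \<open>(d0\<^sup>2 / (lam * eps)) * (lam * M\<^sup>2 / eps) = w ^ 4\<close> and
  \<open>w ^ 3 \<le> 1 + w ^ 4\<close> (\<open>iteration_count_arith\<close>).

  All functions involved are real-valued on the domain of \<open>h\<close>, and the regularized functions are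
  infinite elsewhere; the estimates are therefore carried out with real functions on that convex
  set. They involve nothing but inner products and convex combinations, which is why the constant
  is the same in every dimension.
\<close>

section \<open>Strong convexity at a proximal point\<close>

text \<open>
  Minimality is tested at points of the segment from \<open>x\<close> to \<open>u\<close>; along the segment the squared norm
  falls short of its linear interpolation by \<open>t * (1 - t) * (norm (u - x))\<^sup>2\<close>, and letting the point
  tend to \<open>x\<close> leaves the extra quadratic term.
\<close>

lemma prox_three_point:
  fixes c :: "'a::real_inner"
  assumes g: "convex_on D g" and x: "x \<in> D" and u: "u \<in> D"
    and min: "\<And>z. z \<in> D \<Longrightarrow> g x + a * (norm (x - c))\<^sup>2 \<le> g z + a * (norm (z - c))\<^sup>2"
  shows "g x + a * (norm (x - c))\<^sup>2 + a * (norm (u - x))\<^sup>2 \<le> g u + a * (norm (u - c))\<^sup>2"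
proof -
  let ?R = "g u + a * (norm (u - c))\<^sup>2 - (g x + a * (norm (x - c))\<^sup>2)"
  have "a * (norm (u - x))\<^sup>2 \<le> ?R"
  proof (rule field_le_mult_one_interval)
    fix r :: real assume r: "0 < r" "r < 1"
    define t where "t = 1 - r"
    have t: "0 < t" "t < 1" using r by (auto simp: t_def)
    define z where "z = (1 - t) *\<^sub>R x + t *\<^sub>R u"
    have "z \<in> D"
      using convex_on_imp_convex[OF g] x u t unfolding z_def by (auto simp: convex_alt)
    have gz: "g z \<le> (1 - t) * g x + t * g u"
      unfolding z_def using convex_onD[OF g _ _ x u, of t] t by simp
    have nz: "(norm (z - c))\<^sup>2 = (1 - t) * (norm (x - c))\<^sup>2 + t * (norm (u - c))\<^sup>2
        - t * (1 - t) * (norm (u - x))\<^sup>2"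
    proof -
      have "z - c = (1 - t) *\<^sub>R (x - c) + t *\<^sub>R (u - c)" "u - x = (u - c) - (x - c)"
        by (simp_all add: z_def algebra_simps)
      then show ?thesis
        unfolding power2_norm_eq_inner
        by (simp only: inner_diff_left inner_diff_right inner_add_left inner_add_right
            inner_scaleR_left inner_scaleR_right inner_commute[of "x - c" "u - c"])
          (simp add: algebra_simps)
    qed
    have "g x + a * (norm (x - c))\<^sup>2 \<le> g z + a * (norm (z - c))\<^sup>2"
      by (rule min) fact
    then have "t * (r * (a * (norm (u - x))\<^sup>2)) \<le> t * ?R"
      using gz unfolding nz by (simp add: t_def algebra_simps)
    then show "r * (a * (norm (u - x))\<^sup>2) \<le> ?R"
      using t by simp
  qed
  then show ?thesis by simp
qed

section \<open>The composite problem on the domain of the second summand\<close>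

text \<open>
  The finite part of an extended-valued function, kept as a constant of its own so that
  \<open>g u = ereal (real_fun g u)\<close> terminates as a rewrite rule.
\<close>

definition real_fun :: "('a \<Rightarrow> ereal) \<Rightarrow> 'a \<Rightarrow> real" where
  "real_fun g u = real_of_ereal (g u)"

lemma proper_fun_real:
  assumes "proper_fun V g" "u \<in> edom V g"
  shows "g u = ereal (real_fun g u)"
  using assms by (cases "g u") (auto simp: proper_fun_def edom_def real_fun_def)

lemma convex_edom:
  assumes "convex V" "proper_fun V g" "convex_fun V g"
  shows "convex (edom V g)"
  unfolding convex_alt
proof (intro ballI allI impI)
  fix x y and t :: real
  assume x: "x \<in> edom V g" and y: "y \<in> edom V g" and t: "0 \<le> t \<and> t \<le> 1"
  let ?z = "(1 - t) *\<^sub>R x + t *\<^sub>R y"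
  have V: "x \<in> V" "y \<in> V" using x y by (auto simp: edom_def)
  show "?z \<in> edom V g"
  proof (cases "t = 0 \<or> t = 1")
    case True
    then show ?thesis using x y by (elim disjE) simp_all
  next
    case False
    then have t: "t \<in> {0<..<1}" using t by auto
    have "?z \<in> V" using assms(1) V t by (auto simp: convex_alt)
    moreover have "g ?z \<le> ereal (1 - t) * g x + ereal t * g y"
      using assms(3) V t unfolding convex_fun_def by blast
    moreover obtain b d where "g x = ereal b" "g y = ereal d"
      using proper_fun_real[OF assms(2)] x y by blast
    ultimately show ?thesis by (cases "g ?z") (simp_all add: edom_def)
  qed
qed

lemma convex_on_real:
  assumes "convex D" "D \<subseteq> edom V g" "proper_fun V g" "convex_fun V g"
  shows "convex_on D (real_fun g)"
proof (rule convex_onI)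
  fix t :: real and x y assume t: "0 < t" "t < 1" and xy: "x \<in> D" "y \<in> D"
  let ?z = "(1 - t) *\<^sub>R x + t *\<^sub>R y"
  have xy_V: "x \<in> V" "y \<in> V" using xy assms(2) by (auto simp: edom_def)
  have z: "?z \<in> D" using assms(1) xy t by (auto simp: convex_alt)
  have "g ?z \<le> ereal (1 - t) * g x + ereal t * g y"
    using assms(4) t xy_V unfolding convex_fun_def by simp
  moreover obtain a b d where "g ?z = ereal a" "g x = ereal b" "g y = ereal d"
    using proper_fun_real[OF assms(3)] assms(2) z xy by blast
  ultimately show "real_fun g ?z \<le> (1 - t) * real_fun g x + t * real_fun g y"
    by (simp add: real_fun_def)
qed (fact assms(1))

locale composite =
  fixes V :: "'a::real_inner set" and f h :: "'a \<Rightarrow> ereal" and f' :: "'a \<Rightarrow> 'a" and M :: real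
  assumes convex_V: "convex V" and problem: "problem V f h f' M"
begin

abbreviation "D \<equiv> edom V h"
abbreviation "F \<equiv> real_fun f"
abbreviation "H \<equiv> real_fun h"

lemma
  shows plc_f: "proper_fun V f" "convex_fun V f"
    and plc_h: "proper_fun V h" "convex_fun V h"
    and D_subset: "D \<subseteq> edom V f"
    and M_pos: "M > 0"
    and norm_f': "u \<in> D \<Longrightarrow> norm (f' u) \<le> M"
    and subdiff_f': "u \<in> D \<Longrightarrow> f' u \<in> subdiff V f u"
  using problem by (auto simp: problem_def plc_fun_def)

lemma D_in_V: "u \<in> D \<Longrightarrow> u \<in> V"
  by (simp add: edom_def)

lemma f_eq: "u \<in> D \<Longrightarrow> f u = ereal (F u)"
  using D_subset by (intro proper_fun_real[OF plc_f(1)]) blast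

lemma h_eq: "u \<in> D \<Longrightarrow> h u = ereal (H u)"
  by (rule proper_fun_real[OF plc_h(1)])

lemma h_outside: "u \<in> V \<Longrightarrow> u \<notin> D \<Longrightarrow> h u = \<infinity>"
  by (simp add: edom_def)

lemma f_not_MInf: "u \<in> V \<Longrightarrow> f u \<noteq> -\<infinity>"
  using plc_f(1) by (simp add: proper_fun_def)

lemma convex_D: "convex D"
  using convex_V plc_h by (rule convex_edom)

lemma convex_F: "convex_on D F"
  using convex_D D_subset plc_f by (rule convex_on_real)

lemma convex_H: "convex_on D H"
  using convex_D order_refl plc_h by (rule convex_on_real)

lemma linearization_le_f:
  assumes "v \<in> D" "u \<in> V" shows "linearization f f' v u \<le> f u"
  using subdiff_f'[OF assms(1)] assms(2) by (auto simp: subdiff_def linearization_def)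

lemma linearization_eq:
  "v \<in> D \<Longrightarrow> linearization f f' v u = ereal (F v + inner (f' v) (u - v))"
  by (simp add: linearization_def f_eq)

lemma subgradient_ineq:
  assumes "u \<in> D" "v \<in> D"
  shows "F v + inner (f' v) (u - v) \<le> F u"
  using linearization_le_f[OF assms(2) D_in_V[OF assms(1)]]
  by (simp add: linearization_eq f_eq assms)

text \<open>
  The subgradient inequality at \<open>u\<close> bounds \<open>F u - F v\<close> by \<open>inner (f' u) (u - v)\<close>, so the error is at
  most the inner product of \<open>f' u - f' v\<close> with \<open>u - v\<close>.
\<close>

lemma linearization_error:
  assumes u: "u \<in> D" and v: "v \<in> D"
  shows "F u - (F v + inner (f' v) (u - v)) \<le> 2 * M * norm (u - v)"
proof -
  have "F u + inner (f' u) (v - u) \<le> F v"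
    using subgradient_ineq[OF v u] .
  moreover have "inner (f' u - f' v) (u - v) \<le> (M + M) * norm (u - v)"
    using norm_f'[OF u] norm_f'[OF v] norm_triangle_ineq4[of "f' u" "f' v"]
    by (intro order_trans[OF norm_cauchy_schwarz] mult_right_mono) auto
  ultimately show ?thesis
    by (simp add: inner_diff_left inner_diff_right algebra_simps)
qed

lemma minimizerD:
  assumes "xs \<in> minimizers V (\<lambda>u. f u + h u)"
  shows "xs \<in> D" "u \<in> D \<Longrightarrow> F xs + H xs \<le> F u + H u"
proof -
  have xs: "xs \<in> V" "\<And>u. u \<in> V \<Longrightarrow> f xs + h xs \<le> f u + h u"
    using assms by (auto simp: minimizers_def is_arg_min_def not_less)
  obtain w where w: "w \<in> D" using plc_h(1) by (auto simp: proper_fun_def)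
  have "f xs + h xs \<le> ereal (F w + H w)"
    using xs(2)[OF D_in_V[OF w]] by (simp add: f_eq[OF w] h_eq[OF w])
  then show D: "xs \<in> D"
    using xs(1) f_not_MInf[of xs] by (cases "h xs") (auto simp: edom_def)
  show "u \<in> D \<Longrightarrow> F xs + H xs \<le> F u + H u"
    using xs(2)[of u] by (simp add: f_eq h_eq D D_in_V)
qed

section \<open>Approximate proximal steps\<close>

text \<open>
  All that the outer loop needs to know about a call: from center \<open>c\<close> to the next center \<open>c'\<close>, with
  primal output \<open>p\<close> and dual output \<open>q\<close>. The number \<open>\<gamma>\<close> is the value of the last model of \<open>f\<close> at
  \<open>c'\<close>. The first clause says that \<open>q\<close> is a subgradient of a minorant of \<open>f\<close>, the second
  that \<open>-q\<close> is a subgradient of the regularized \<open>h\<close> at \<open>c'\<close> (in the form that strong convexity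
  gives), and the third that the gap at \<open>p\<close> is at most \<open>eps\<close>.
\<close>

definition approx_prox_step :: "real \<Rightarrow> real \<Rightarrow> 'a \<Rightarrow> 'a \<Rightarrow> 'a \<Rightarrow> 'a \<Rightarrow> bool" where
  "approx_prox_step lam eps c c' p q \<longleftrightarrow> c' \<in> D \<and> p \<in> D \<and>
    (\<exists>\<gamma>. (\<forall>u\<in>V. ereal (\<gamma> + inner q (u - c')) \<le> f u) \<and>
      (\<forall>u\<in>D. H c' + 1 / (2 * lam) * (norm (c' - c))\<^sup>2 + 1 / (2 * lam) * (norm (u - c'))\<^sup>2
              \<le> H u + inner q (u - c') + 1 / (2 * lam) * (norm (u - c))\<^sup>2) \<and>
      F p + H p + 1 / (2 * lam) * (norm (p - c))\<^sup>2
        \<le> \<gamma> + H c' + 1 / (2 * lam) * (norm (c' - c))\<^sup>2 + eps)"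

text \<open>
  The sum of the three clauses of the certificate: the linear terms in \<open>q\<close> cancel.
\<close>

lemma approx_prox_step_descent:
  assumes "approx_prox_step lam eps c c' p q" and u: "u \<in> D"
  shows "F p + H p + 1 / (2 * lam) * (norm (p - c))\<^sup>2 + 1 / (2 * lam) * (norm (u - c'))\<^sup>2
    \<le> F u + H u + 1 / (2 * lam) * (norm (u - c))\<^sup>2 + eps"
proof -
  obtain \<gamma> where g: "\<forall>u\<in>V. ereal (\<gamma> + inner q (u - c')) \<le> f u"
    and rest: "\<forall>u\<in>D. H c' + 1 / (2 * lam) * (norm (c' - c))\<^sup>2 + 1 / (2 * lam) * (norm (u - c'))\<^sup>2
              \<le> H u + inner q (u - c') + 1 / (2 * lam) * (norm (u - c))\<^sup>2"
      "F p + H p + 1 / (2 * lam) * (norm (p - c))\<^sup>2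
        \<le> \<gamma> + H c' + 1 / (2 * lam) * (norm (c' - c))\<^sup>2 + eps"
    using assms(1) unfolding approx_prox_step_def by blast
  have "\<gamma> + inner q (u - c') \<le> F u"
    using g D_in_V[OF u] f_eq[OF u] by force
  then show ?thesis using rest(1)[rule_format, OF u] rest(2) by linarith
qed

text \<open>
  The descent inequality at a minimizer, whose value is at most that of \<open>p\<close>, and at \<open>p\<close> itself.
\<close>

lemma approx_prox_step_distance:
  assumes step: "approx_prox_step lam eps c c' p q" and lam: "lam > 0"
  shows "xs \<in> minimizers V (\<lambda>u. f u + h u) \<Longrightarrow>
      (norm (xs - c'))\<^sup>2 \<le> (norm (xs - c))\<^sup>2 + 2 * (lam * eps)"
    and "(norm (p - c'))\<^sup>2 \<le> 2 * (lam * eps)"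
proof -
  have p: "p \<in> D" using step by (simp add: approx_prox_step_def)
  show "(norm (p - c'))\<^sup>2 \<le> 2 * (lam * eps)"
    using approx_prox_step_descent[OF step p] lam by (simp add: field_simps)
  assume xs: "xs \<in> minimizers V (\<lambda>u. f u + h u)"
  have "0 \<le> 1 / (2 * lam) * (norm (p - c))\<^sup>2" using lam by simp
  then have "1 / (2 * lam) * (norm (xs - c'))\<^sup>2 \<le> 1 / (2 * lam) * (norm (xs - c))\<^sup>2 + eps"
    using approx_prox_step_descent[OF step minimizerD(1)[OF xs]] minimizerD(2)[OF xs p]
    by linarith
  then show "(norm (xs - c'))\<^sup>2 \<le> (norm (xs - c))\<^sup>2 + 2 * (lam * eps)"
    using lam by (simp add: field_simps)
qed

lemma prox_chain_distance:
  assumes "\<And>i. i \<in> {1..k} \<Longrightarrow> approx_prox_step lam eps (c (i - 1)) (c i) (p i) (q i)"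
    and "lam > 0" and "xs \<in> minimizers V (\<lambda>u. f u + h u)"
  shows "(norm (xs - c k))\<^sup>2 \<le> (norm (xs - c 0))\<^sup>2 + 2 * (real k * (lam * eps))"
  using assms(1)
proof (induction k)
  case (Suc k)
  have "(norm (xs - c (Suc k)))\<^sup>2 \<le> (norm (xs - c k))\<^sup>2 + 2 * (lam * eps)"
    using approx_prox_step_distance(1)[OF Suc.prems[of "Suc k"] assms(2,3)] by simp
  moreover have "(norm (xs - c k))\<^sup>2 \<le> (norm (xs - c 0))\<^sup>2 + 2 * (real k * (lam * eps))"
    using Suc by simp
  ultimately show ?case by (simp add: algebra_simps)
qed simp

text \<open>
  For each step, the minorant of \<open>f\<close> bounds the conjugate of \<open>f\<close> at \<open>q i\<close> and the lower bound for
  \<open>h\<close> bounds the conjugate of \<open>h\<close> at \<open>- q i\<close>. The second bound carries a term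
  proportional to \<open>(norm (u - c (i - 1)))\<^sup>2 - (norm (u - c i))\<^sup>2\<close>, which telescopes over the steps and is
  at most \<open>R\<^sup>2\<close> on the ball; this is the reason for restricting \<open>h\<close> to a ball. Jensen's
  inequality passes from the points \<open>p i\<close> to their average.
\<close>

lemma prox_chain_gap:
  fixes R :: real
  assumes steps: "\<And>i. i \<in> {1..k} \<Longrightarrow> approx_prox_step lam eps (c (i - 1)) (c i) (p i) (q i)"
    and ball: "\<And>i. i \<in> {1..k} \<Longrightarrow> p i \<in> cball (c 0) R"
    and lam: "lam > 0" and k: "k \<ge> 1" and R: "R \<ge> 0"
  shows "pd_gap V f h (cball (c 0) R)
      ((1 / real k) *\<^sub>R (\<Sum>i=1..k. p i)) ((1 / real k) *\<^sub>R (\<Sum>i=1..k. q i))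
    \<le> ereal (eps + R\<^sup>2 / (2 * lam * real k))"
proof -
  define a where "a = 1 / (2 * lam)"
  have a: "a > 0" using lam by (simp add: a_def)
  have k0: "real k > 0" using k by simp
  have "\<forall>i\<in>{1..k}. \<exists>\<gamma>. c i \<in> D \<and> p i \<in> D \<and>
      (\<forall>u\<in>V. ereal (\<gamma> + inner (q i) (u - c i)) \<le> f u) \<and>
      (\<forall>u\<in>D. H (c i) + a * (norm (c i - c (i - 1)))\<^sup>2 + a * (norm (u - c i))\<^sup>2
              \<le> H u + inner (q i) (u - c i) + a * (norm (u - c (i - 1)))\<^sup>2) \<and>
      F (p i) + H (p i) + a * (norm (p i - c (i - 1)))\<^sup>2
        \<le> \<gamma> + H (c i) + a * (norm (c i - c (i - 1)))\<^sup>2 + eps"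
    using steps unfolding approx_prox_step_def a_def by blast
  then obtain \<gamma> where
    D: "\<And>i. i \<in> {1..k} \<Longrightarrow> c i \<in> D \<and> p i \<in> D" and
    fl: "\<And>i u. i \<in> {1..k} \<Longrightarrow> u \<in> V \<Longrightarrow> ereal (\<gamma> i + inner (q i) (u - c i)) \<le> f u" and
    hl: "\<And>i u. i \<in> {1..k} \<Longrightarrow> u \<in> D \<Longrightarrow>
      H (c i) + a * (norm (c i - c (i - 1)))\<^sup>2 + a * (norm (u - c i))\<^sup>2
        \<le> H u + inner (q i) (u - c i) + a * (norm (u - c (i - 1)))\<^sup>2" and
    pl: "\<And>i. i \<in> {1..k} \<Longrightarrow> F (p i) + H (p i) + a * (norm (p i - c (i - 1)))\<^sup>2
        \<le> \<gamma> i + H (c i) + a * (norm (c i - c (i - 1)))\<^sup>2 + eps"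
    by metis
  define pk where "pk = (1 / real k) *\<^sub>R (\<Sum>i=1..k. p i)"
  define qk where "qk = (1 / real k) *\<^sub>R (\<Sum>i=1..k. q i)"
  \<comment> \<open>\<open>A / k\<close> will bound the conjugate of \<open>f\<close>, and \<open>(a * R\<^sup>2 - B) / k\<close> that of the restricted \<open>h\<close>.\<close>
  define A where "A = (\<Sum>i=1..k. inner (q i) (c i) - \<gamma> i)"
  define B where "B = (\<Sum>i=1..k. H (c i) + inner (q i) (c i) + a * (norm (c i - c (i - 1)))\<^sup>2)"
  have wt: "(\<Sum>i=1..k. 1 / real k) = 1" using k0 by simp
  have pk': "pk = (\<Sum>i=1..k. (1 / real k) *\<^sub>R p i)"
    by (simp add: pk_def scaleR_sum_right)
  have qk_inner: "real k * inner qk u = (\<Sum>i=1..k. inner (q i) u)" for u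
    using k0 by (simp add: qk_def inner_sum_left)
  have pkD: "pk \<in> D"
    unfolding pk' using wt D convex_D by (intro convex_sum) auto
  have pkQ: "pk \<in> cball (c 0) R"
    unfolding pk' using wt ball by (intro convex_sum convex_cball) auto
  have jensen: "real k * g pk \<le> (\<Sum>i=1..k. g (p i))" if "convex_on D g" for g
  proof -
    have "g pk \<le> (\<Sum>i=1..k. (1 / real k) * g (p i))"
      unfolding pk' using wt D k that by (intro convex_on_sum) auto
    then show ?thesis using k0 by (simp add: sum_divide_distrib[symmetric] field_simps)
  qed
  have primal: "real k * (F pk + H pk) \<le> B - A + real k * eps"
  proof -
    have "real k * (F pk + H pk) \<le> (\<Sum>i=1..k. F (p i) + H (p i))"
      using jensen[OF convex_F] jensen[OF convex_H] by (simp add: sum.distrib algebra_simps)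
    also have "\<dots> \<le> (\<Sum>i=1..k. \<gamma> i + H (c i) + a * (norm (c i - c (i - 1)))\<^sup>2 + eps)"
    proof (rule sum_mono)
      fix i assume "i \<in> {1..k}"
      moreover have "0 \<le> a * (norm (p i - c (i - 1)))\<^sup>2" using a by simp
      ultimately show "F (p i) + H (p i) \<le> \<gamma> i + H (c i) + a * (norm (c i - c (i - 1)))\<^sup>2 + eps"
        using pl[of i] by linarith
    qed
    also have "\<dots> = B - A + real k * eps"
      unfolding A_def B_def by (simp add: sum.distrib sum_subtractf)
    finally show ?thesis .
  qed
  have conj_f: "conjugate V f qk \<le> ereal (A / real k)"
    unfolding conjugate_def
  proof (rule SUP_least)
    fix u assume u: "u \<in> V"
    show "ereal (inner qk u) - f u \<le> ereal (A / real k)"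
    proof (cases "f u")
      case (real r)
      have "(\<Sum>i=1..k. inner (q i) u - r) \<le> A"
        unfolding A_def
      proof (rule sum_mono)
        fix i assume "i \<in> {1..k}"
        from fl[OF this u] show "inner (q i) u - r \<le> inner (q i) (c i) - \<gamma> i"
          by (simp add: real inner_diff_right)
      qed
      then have "real k * (inner qk u - r) \<le> A"
        by (simp add: sum_subtractf right_diff_distrib qk_inner)
      then show ?thesis using k0 by (simp add: real field_simps)
    qed (use f_not_MInf[OF u] in auto)
  qed
  have conj_h: "conjugate V (\<lambda>u. h u + indicator_fun (cball (c 0) R) u) (- qk)
      \<le> ereal ((a * R\<^sup>2 - B) / real k)"
    unfolding conjugate_def
  proof (rule SUP_least)
    fix u assume u: "u \<in> V"
    show "ereal (inner (- qk) u) - (h u + indicator_fun (cball (c 0) R) u)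
      \<le> ereal ((a * R\<^sup>2 - B) / real k)"
    proof (cases "u \<in> D \<and> u \<in> cball (c 0) R")
      case True
      then have uD: "u \<in> D" and uQ: "norm (u - c 0) \<le> R"
        by (auto simp: dist_norm norm_minus_commute)
      have "B \<le> (\<Sum>i=1..k. H u + inner (q i) u
          + (a * (norm (u - c (i - 1)))\<^sup>2 - a * (norm (u - c i))\<^sup>2))"
        unfolding B_def
      proof (rule sum_mono)
        fix i assume "i \<in> {1..k}"
        from hl[OF this uD]
        show "H (c i) + inner (q i) (c i) + a * (norm (c i - c (i - 1)))\<^sup>2 \<le> H u + inner (q i) u
          + (a * (norm (u - c (i - 1)))\<^sup>2 - a * (norm (u - c i))\<^sup>2)"
          by (simp add: inner_diff_right)
      qed
      also have "\<dots> = real k * (H u + inner qk u)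
          + (\<Sum>i=1..k. a * (norm (u - c (i - 1)))\<^sup>2 - a * (norm (u - c i))\<^sup>2)"
        by (simp only: sum.distrib qk_inner distrib_left) simp
      also have "(\<Sum>i=1..k. a * (norm (u - c (i - 1)))\<^sup>2 - a * (norm (u - c i))\<^sup>2)
          = a * (norm (u - c 0))\<^sup>2 - a * (norm (u - c k))\<^sup>2"
        by (induction k) auto
      also have "\<dots> \<le> a * R\<^sup>2"
      proof -
        have "a * (norm (u - c 0))\<^sup>2 \<le> a * R\<^sup>2"
          using a uQ by (intro mult_left_mono power_mono) auto
        moreover have "0 \<le> a * (norm (u - c k))\<^sup>2" using a by simp
        ultimately show ?thesis by linarith
      qed
      finally have "- inner qk u - H u \<le> (a * R\<^sup>2 - B) / real k"
        using k0 by (simp add: field_simps)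
      then show ?thesis using True by (simp add: h_eq[OF uD] indicator_fun_def)
    next
      case False
      moreover have "h u \<noteq> -\<infinity>" using plc_h(1) u by (simp add: proper_fun_def)
      ultimately have inf: "h u + indicator_fun (cball (c 0) R) u = \<infinity>"
        using h_outside[OF u] by (cases "u \<in> D") (auto simp: indicator_fun_def)
      show ?thesis unfolding inf by simp
    qed
  qed
  have "F pk + H pk + A / real k + (a * R\<^sup>2 - B) / real k \<le> eps + a * R\<^sup>2 / real k"
  proof -
    have "F pk + H pk \<le> (B - A) / real k + eps"
      using primal k0 by (simp add: field_simps)
    then show ?thesis by (simp add: diff_divide_distrib)
  qed
  also have "a * R\<^sup>2 / real k = R\<^sup>2 / (2 * lam * real k)"
    by (simp add: a_def)
  finally have tot: "F pk + H pk + A / real k + (a * R\<^sup>2 - B) / real k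
    \<le> eps + R\<^sup>2 / (2 * lam * real k)" .
  have "pd_gap V f h (cball (c 0) R) pk qk
      \<le> ereal (F pk + H pk) + ereal (A / real k) + ereal ((a * R\<^sup>2 - B) / real k)"
    unfolding pd_gap_def Let_def
    using pkQ by (intro add_mono conj_f conj_h) (simp add: f_eq[OF pkD] h_eq[OF pkD] indicator_fun_def)
  also have "\<dots> \<le> ereal (eps + R\<^sup>2 / (2 * lam * real k))"
    using tot by simp
  finally show ?thesis unfolding pk_def qk_def .
qed

section \<open>Cutting-plane models\<close>

text \<open>
  Properties shared by the first linearization, the models \<open>G j\<close> and the auxiliary functions from
  which they are updated. On \<open>D\<close> they are finite, being squeezed between \<open>-\<infinity>\<close> and \<open>f\<close>; outside \<open>D\<close>
  every regularized model is infinite.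
\<close>

definition is_model :: "('a \<Rightarrow> ereal) \<Rightarrow> bool" where
  "is_model g \<longleftrightarrow> (\<forall>u\<in>V. g u \<noteq> -\<infinity> \<and> g u \<le> f u) \<and> convex_on D (real_fun g)"

lemma model_eq:
  assumes "is_model g" "u \<in> D"
  shows "g u = ereal (real_fun g u)"
proof -
  have "g u \<noteq> -\<infinity>" "g u \<le> ereal (F u)"
    using assms D_in_V[OF assms(2)] f_eq[OF assms(2)] by (auto simp: is_model_def)
  then show ?thesis by (cases "g u") (auto simp: real_fun_def)
qed

lemma model_le:
  assumes "is_model g" "u \<in> D"
  shows "real_fun g u \<le> F u"
proof -
  have "g u \<le> f u" using assms D_in_V[OF assms(2)] by (auto simp: is_model_def)
  then show ?thesis by (simp add: model_eq[OF assms] f_eq[OF assms(2)])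
qed

lemma plc_is_model:
  assumes "plc_fun V g" "\<forall>u\<in>V. g u \<le> f u"
  shows "is_model g"
proof -
  have "D \<subseteq> edom V g"
    using D_subset assms(2) by (force simp: edom_def)
  then show ?thesis
    using assms convex_on_real[OF convex_D] by (auto simp: is_model_def plc_fun_def proper_fun_def)
qed

lemma linearization_is_model:
  assumes v: "v \<in> D" and g: "\<forall>u\<in>V. g u = linearization f f' v u"
  shows "is_model g"
proof -
  have eq: "real_fun g u = F v + inner (f' v) (u - v)" if "u \<in> D" for u
    using g D_in_V[OF that] by (simp add: real_fun_def linearization_eq[OF v])
  have "convex_on D (real_fun g)"
  proof (rule convex_onI)
    fix t :: real and x y assume t: "0 < t" "t < 1" and xy: "x \<in> D" "y \<in> D"
    have "(1 - t) *\<^sub>R x + t *\<^sub>R y \<in> D" using convex_D xy t by (auto simp: convex_alt)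
    then show "real_fun g ((1 - t) *\<^sub>R x + t *\<^sub>R y) \<le> (1 - t) * real_fun g x + t * real_fun g y"
      by (simp add: eq xy inner_diff_right inner_add_right algebra_simps)
  qed (fact convex_D)
  then show ?thesis
    using g linearization_le_f[OF v] by (auto simp: is_model_def linearization_eq[OF v])
qed

lemma prox_reg_eq:
  "u \<in> D \<Longrightarrow> prox_reg h lam c u = ereal (H u + 1 / (2 * lam) * (norm (u - c))\<^sup>2)"
  by (simp add: prox_reg_def h_eq)

text \<open>
  Used to see that iterates, of which only \<open>v \<in> V\<close> and a finite regularized value are known, lie
  in the domain of \<open>h\<close>.
\<close>

lemma finite_regularized:
  assumes "v \<in> V" "g v \<noteq> -\<infinity>" "g v + prox_reg h lam c v \<le> ereal r"
  shows "v \<in> D"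
proof (rule ccontr)
  assume "v \<notin> D"
  then have "prox_reg h lam c v = \<infinity>" using h_outside[OF assms(1)] by (simp add: prox_reg_def)
  then show False using assms(2,3) by (cases "g v") auto
qed

lemma model_argmin:
  assumes g: "is_model g" and c: "c \<in> D"
    and z: "is_arg_min (\<lambda>u. g u + prox_reg h lam c u) (\<lambda>u. u \<in> V) z"
  shows "z \<in> D"
    and "(INF u\<in>V. g u + prox_reg h lam c u)
      = ereal (real_fun g z + H z + 1 / (2 * lam) * (norm (z - c))\<^sup>2)"
    and "u \<in> D \<Longrightarrow> real_fun g z + H z + 1 / (2 * lam) * (norm (z - c))\<^sup>2
        + 1 / (2 * lam) * (norm (u - z))\<^sup>2
      \<le> real_fun g u + H u + 1 / (2 * lam) * (norm (u - c))\<^sup>2"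
proof -
  have zV: "z \<in> V" and min: "\<And>u. u \<in> V \<Longrightarrow> g z + prox_reg h lam c z \<le> g u + prox_reg h lam c u"
    using z by (auto simp: is_arg_min_def not_less)
  have eq: "g u + prox_reg h lam c u
      = ereal (real_fun g u + H u + 1 / (2 * lam) * (norm (u - c))\<^sup>2)" if "u \<in> D" for u
    by (simp add: model_eq[OF g that] prox_reg_eq[OF that])
  show zD: "z \<in> D"
  proof (rule finite_regularized[OF zV])
    show "g z \<noteq> -\<infinity>" using g zV by (simp add: is_model_def)
    show "g z + prox_reg h lam c z \<le> ereal (real_fun g c + H c + 1 / (2 * lam) * (norm (c - c))\<^sup>2)"
      using min[OF D_in_V[OF c]] unfolding eq[OF c] .
  qed
  have "(INF u\<in>V. g u + prox_reg h lam c u) = g z + prox_reg h lam c z"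
    using zV min by (intro antisym INF_lower INF_greatest)
  then show "(INF u\<in>V. g u + prox_reg h lam c u)
      = ereal (real_fun g z + H z + 1 / (2 * lam) * (norm (z - c))\<^sup>2)"
    by (simp only: eq[OF zD])
  assume u: "u \<in> D"
  have "convex_on D (\<lambda>u. real_fun g u + H u)"
    using g convex_H by (auto simp: is_model_def intro: convex_on_add)
  from prox_three_point[OF this zD u, of "1 / (2 * lam)" c]
  show "real_fun g z + H z + 1 / (2 * lam) * (norm (z - c))\<^sup>2 + 1 / (2 * lam) * (norm (u - z))\<^sup>2
      \<le> real_fun g u + H u + 1 / (2 * lam) * (norm (u - c))\<^sup>2"
    using min[OF D_in_V] eq eq[OF zD] by simp
qed

end

section \<open>One call of the cutting-plane method\<close>

text \<open>
  The factor \<open>(j + 1) * (j + 2)\<close> turns the recursion into one for \<open>j * (j + 1) * t j\<close>, whose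
  increments \<open>8 * L * (j + 1) / j\<close> are at most \<open>16 * L\<close>.
\<close>

lemma gap_recursion_bound:
  fixes t :: "nat \<Rightarrow> real"
  assumes n: "n \<ge> 1" and L: "L \<ge> 0"
    and rec: "\<And>j. 1 \<le> j \<Longrightarrow> j < n \<Longrightarrow>
      t (j + 1) \<le> real j / (real j + 2) * t j + 8 * L / (real j * (real j + 2))"
  shows "real n * (real n + 1) * t n \<le> 2 * t 1 + 16 * L * (real n - 1)"
  using n rec
proof (induction n rule: dec_induct)
  case (step j)
  let ?j = "real j"
  have j: "?j \<ge> 1" using step.hyps by simp
  have "t (j + 1) \<le> ?j / (?j + 2) * t j + 8 * L / (?j * (?j + 2))"
    using step.prems[of j] step.hyps by simp
  then have "(?j + 1) * (?j + 2) * t (j + 1)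
      \<le> (?j + 1) * (?j + 2) * (?j / (?j + 2) * t j + 8 * L / (?j * (?j + 2)))"
    using j by (intro mult_left_mono) auto
  also have "\<dots> = ?j * (?j + 1) * t j + 8 * L * ((?j + 1) / ?j)"
  proof -
    have "(w + 1) * (w + 2) * (w / (w + 2) * a + 8 * L / (w * (w + 2)))
        = w * (w + 1) * a + 8 * L * ((w + 1) / w)" if "w \<ge> 1" for w a :: real
    proof -
      have "w \<noteq> 0" "w + 2 \<noteq> 0" using that by auto
      then show ?thesis by (simp add: divide_simps) (simp add: algebra_simps)
    qed
    from this[OF j] show ?thesis .
  qed
  also have "\<dots> \<le> ?j * (?j + 1) * t j + 8 * L * 2"
    using j L by (intro add_left_mono mult_left_mono) (auto simp: field_simps)
  also have "\<dots> \<le> 2 * t 1 + 16 * L * ?j"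
    using step.IH step.prems by (simp add: algebra_simps)
  finally show ?case by (simp add: algebra_simps)
qed simp

locale pdcp_call = composite +
  fixes lam eps :: real and c :: 'a and tau :: "nat \<Rightarrow> real"
    and G :: "nat \<Rightarrow> 'a \<Rightarrow> ereal" and x y s :: "nat \<Rightarrow> 'a"
  assumes lam_pos: "lam > 0" and eps_pos: "eps > 0" and center: "c \<in> D"
    and run: "pdcp_run V f h f' lam eps c tau G x y s"
    and tau: "j \<ge> 1 \<Longrightarrow> tau j = real j / (real j + 2)"
begin

abbreviation "active \<equiv> pdcp_active V f h lam eps c G y"
abbreviation "gap \<equiv> pdcp_gap V f h lam c G y"

text \<open>
  In the notation of the informal statement, \<open>Psi\<close> is $\phi^\lambda$, \<open>m j\<close> is $m_j$ and \<open>t j\<close> is $t_j$.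
\<close>

definition prox :: "'a \<Rightarrow> real" where "prox u = 1 / (2 * lam) * (norm (u - c))\<^sup>2"
definition Psi :: "'a \<Rightarrow> real" where "Psi u = F u + H u + prox u"
definition m :: "nat \<Rightarrow> real" where "m j = real_fun (G j) (x j) + H (x j) + prox (x j)"
definition t :: "nat \<Rightarrow> real" where "t j = Psi (y j) - m j"

lemma active_1: "active 1"
  by (simp add: pdcp_active_def)

lemma active_mono: "active j \<Longrightarrow> 1 \<le> i \<Longrightarrow> i \<le> j \<Longrightarrow> active i"
  by (auto simp: pdcp_active_def)

lemma active_ge_1: "active j \<Longrightarrow> j \<ge> 1"
  by (simp add: pdcp_active_def)

lemma iterate:
  assumes "active j"
  shows "is_arg_min (\<lambda>u. G j u + prox_reg h lam c u) (\<lambda>u. u \<in> V) (x j)"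
    "s j \<in> subdiff V (G j) (x j)" "- s j \<in> subdiff V (prox_reg h lam c) (x j)"
    "y j \<in> V" "j = 1 \<Longrightarrow> y j = x j"
    "j \<ge> 2 \<Longrightarrow> f (y j) + prox_reg h lam c (y j)
          \<le> ereal (tau (j - 1)) * (f (y (j - 1)) + prox_reg h lam c (y (j - 1)))
            + ereal (1 - tau (j - 1)) * (f (x j) + prox_reg h lam c (x j))"
  using run assms unfolding pdcp_run_def by auto

lemma update:
  assumes "active (j + 1)" "j \<ge> 1"
  shows "model_update V f h f' lam c (tau j) (x j) (G j) (G (j + 1))"
  using run assms unfolding pdcp_run_def by blast

lemma model_G:
  assumes "active j" shows "is_model (G j)"
proof (cases "j = 1")
  case True
  then show ?thesis
    using run center by (intro linearization_is_model[of c]) (auto simp: pdcp_run_def)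
next
  case False
  then have "active ((j - 1) + 1)" "j - 1 \<ge> 1" using assms active_ge_1[OF assms] by auto
  from update[OF this] False active_ge_1[OF assms] show ?thesis
    by (intro plc_is_model) (auto simp: model_update_def)
qed

lemma x_in_D: "active j \<Longrightarrow> x j \<in> D"
  using model_argmin(1)[OF model_G center iterate(1)] .

lemma Psi_eq: "u \<in> D \<Longrightarrow> f u + prox_reg h lam c u = ereal (Psi u)"
  by (simp add: f_eq prox_reg_eq Psi_def prox_def)

text \<open>
  That \<open>y j\<close> has a finite value is not part of the scheme; it propagates from \<open>y 1 = x 1\<close> through
  the descent condition.
\<close>

lemma y_step:
  assumes "active j"
  shows "y j \<in> D" "j \<ge> 2 \<Longrightarrow> Psi (y j) \<le> tau (j - 1) * Psi (y (j - 1)) + (1 - tau (j - 1)) * Psi (x j)"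
proof -
  have descent: "f (y i) + prox_reg h lam c (y i)
      \<le> ereal (tau (i - 1) * Psi (y (i - 1)) + (1 - tau (i - 1)) * Psi (x i))"
    if i: "active i" "i \<ge> 2" and D: "y (i - 1) \<in> D" for i
    using iterate(6)[OF i] by (simp add: Psi_eq[OF D] Psi_eq[OF x_in_D[OF i(1)]] del: One_nat_def)
  have yD: "active i \<Longrightarrow> y i \<in> D" for i
  proof (induction i rule: less_induct)
    case (less i)
    show ?case
    proof (cases "i = 1")
      case True
      then show ?thesis using iterate(5)[OF less.prems] x_in_D[OF less.prems] by simp
    next
      case False
      then have i: "i \<ge> 2" using active_ge_1[OF less.prems] by simp
      have "y (i - 1) \<in> D"
        using less.IH[of "i - 1"] active_mono[OF less.prems, of "i - 1"] i by simp
      from descent[OF less.prems i this] show ?thesis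
        using iterate(4)[OF less.prems] f_not_MInf by (intro finite_regularized) auto
    qed
  qed
  show D: "y j \<in> D" by (rule yD) fact
  assume j: "j \<ge> 2"
  then have "y (j - 1) \<in> D" using yD active_mono[OF assms, of "j - 1"] by simp
  from descent[OF assms j this]
  show "Psi (y j) \<le> tau (j - 1) * Psi (y (j - 1)) + (1 - tau (j - 1)) * Psi (x j)"
    by (simp add: Psi_eq[OF D])
qed

lemma gap_eq: "active j \<Longrightarrow> gap j = ereal (t j)"
  unfolding pdcp_gap_def
  by (subst model_argmin(2)[OF model_G center iterate(1)])
    (simp_all add: Psi_eq[OF y_step(1)] t_def m_def prox_def)

lemma m_strong_min:
  assumes "active j" "u \<in> D"
  shows "m j + 1 / (2 * lam) * (norm (u - x j))\<^sup>2 \<le> real_fun (G j) u + H u + prox u"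
  using model_argmin(3)[OF model_G[OF assms(1)] center iterate(1)[OF assms(1)] assms(2)]
  by (simp add: m_def prox_def)

text \<open>
  At the new iterate \<open>u\<close> the new model is at least the \<open>tau j\<close>-weighted mean of the old auxiliary model,
  which exceeds \<open>m j\<close> by a quadratic in \<open>d = norm (u - x j)\<close>, and of the linearization, which misses
  \<open>f\<close> by at most \<open>2 * M * d\<close>. The quadratic absorbs the linear term in \<open>d\<close> up to a constant.
\<close>

lemma gap_step:
  assumes act: "active (j + 1)" and j: "j \<ge> 1"
  shows "t (j + 1) \<le> real j / (real j + 2) * t j + 8 * (lam * M\<^sup>2) / (real j * (real j + 2))"
proof -
  define r where "r = tau j"
  have j0: "real j \<ge> 1" using j by simp
  have r_eq: "r = real j / (real j + 2)" using tau[OF j] by (simp add: r_def)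
  have r: "0 < r" "r < 1" using j0 by (auto simp: r_eq)
  have act_j: "active j" using active_mono[OF act j] by simp
  define u where "u = x (j + 1)"
  have uD: "u \<in> D" and xD: "x j \<in> D"
    using x_in_D[OF act] x_in_D[OF act_j] by (auto simp: u_def)
  define d where "d = norm (u - x j)"
  obtain B where "plc_fun V B" "\<forall>u\<in>V. B u \<le> f u" and B_eq: "B (x j) = G j (x j)"
    and B_min: "is_arg_min (\<lambda>u. B u + prox_reg h lam c u) (\<lambda>u. u \<in> V) (x j)"
    and B_le: "\<forall>u\<in>V. ereal r * B u + ereal (1 - r) * linearization f f' (x j) u \<le> G (j + 1) u"
    using update[OF act j] unfolding model_update_def r_def by blast
  then have B: "is_model B" by (intro plc_is_model)
  have "real_fun B (x j) = real_fun (G j) (x j)"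
    by (simp add: real_fun_def B_eq)
  with model_argmin(3)[OF B center B_min uD]
  have 1: "m j + 1 / (2 * lam) * d\<^sup>2 \<le> real_fun B u + H u + prox u"
    by (simp add: m_def prox_def d_def)
  have 2: "F u - 2 * M * d \<le> F (x j) + inner (f' (x j)) (u - x j)"
    using linearization_error[OF uD xD] by (simp add: d_def)
  have 3: "r * real_fun B u + (1 - r) * (F (x j) + inner (f' (x j)) (u - x j))
      \<le> real_fun (G (j + 1)) u"
    using B_le[rule_format, OF D_in_V[OF uD]]
    by (simp add: model_eq[OF B uD] model_eq[OF model_G[OF act] uD] linearization_eq[OF xD] del: One_nat_def)
  have "r * (m j + 1 / (2 * lam) * d\<^sup>2) + (1 - r) * (Psi u - 2 * M * d)
      \<le> r * (real_fun B u + H u + prox u)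
        + (1 - r) * (F (x j) + inner (f' (x j)) (u - x j) + H u + prox u)"
  proof (rule add_mono)
    show "r * (m j + 1 / (2 * lam) * d\<^sup>2) \<le> r * (real_fun B u + H u + prox u)"
      using r by (intro mult_left_mono 1) simp
    show "(1 - r) * (Psi u - 2 * M * d)
        \<le> (1 - r) * (F (x j) + inner (f' (x j)) (u - x j) + H u + prox u)"
      using r 2 unfolding Psi_def by (intro mult_left_mono) linarith+
  qed
  also have "\<dots> \<le> m (j + 1)"
    using 3 by (simp add: m_def u_def algebra_simps)
  finally have m_low: "r * m j + (1 - r) * Psi u + (r / (2 * lam) * d\<^sup>2 - 2 * (1 - r) * M * d)
      \<le> m (j + 1)"
    by (simp add: algebra_simps)
  \<comment> \<open>Completing the square in \<open>d\<close>.\<close>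
  have "0 \<le> r / (2 * lam) * (d - 2 * lam * M * (1 - r) / r)\<^sup>2"
    using r lam_pos by simp
  also have "\<dots> = r / (2 * lam) * d\<^sup>2 - 2 * (1 - r) * M * d + 2 * lam * M\<^sup>2 * ((1 - r)\<^sup>2 / r)"
    using r lam_pos by (simp add: power2_eq_square field_simps)
  also have "(1 - r)\<^sup>2 / r = 4 / (real j * (real j + 2))"
  proof -
    have "1 - r = 2 / (real j + 2)" using j0 by (simp add: r_eq field_simps)
    moreover have "(2 / (w + 2))\<^sup>2 / (w / (w + 2)) = 4 / (w * (w + 2))" if "w \<ge> 1" for w :: real
    proof -
      have "w \<noteq> 0" "w + 2 \<noteq> 0" using that by auto
      then show ?thesis by (simp add: power2_eq_square divide_simps)
    qed
    ultimately show ?thesis using j0 by (simp only: r_eq)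
  qed
  finally have quad: "- (8 * (lam * M\<^sup>2) / (real j * (real j + 2)))
      \<le> r / (2 * lam) * d\<^sup>2 - 2 * (1 - r) * M * d"
    by (simp add: algebra_simps)
  have "Psi (y (j + 1)) \<le> r * Psi (y j) + (1 - r) * Psi u"
    using y_step(2)[OF act] j by (simp add: r_def u_def)
  then have "t (j + 1) \<le> r * t j + 8 * (lam * M\<^sup>2) / (real j * (real j + 2))"
    using m_low quad unfolding t_def by (simp add: algebra_simps)
  then show ?thesis by (simp only: r_eq)
qed

text \<open>
  The first model is a linearization, so \<open>t 1 \<le> 2 * M * r\<close> with \<open>r = norm (x 1 - c)\<close>. Comparing the
  regularized model at \<open>x 1\<close> and at the minimizer, where the objective is not larger than at \<open>x 1\<close>,
  gives \<open>r\<^sup>2 \<le> 4 * lam * M * r + R\<^sup>2\<close> and hence \<open>r \<le> 4 * lam * M + R\<close>.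
\<close>

lemma first_gap:
  assumes xs: "xs \<in> minimizers V (\<lambda>u. f u + h u)" and R: "norm (xs - c) \<le> R"
  shows "t 1 \<le> 8 * (lam * M\<^sup>2) + 2 * M * R"
proof -
  define r where "r = norm (x 1 - c)"
  have x1: "x 1 \<in> D" by (rule x_in_D[OF active_1])
  have xsD: "xs \<in> D" using xs by (rule minimizerD)
  have R0: "R \<ge> 0" using R norm_ge_zero order_trans by blast
  have "real_fun (G 1) (x 1) = F c + inner (f' c) (x 1 - c)"
    using run D_in_V[OF x1] linearization_eq[OF center] by (simp add: pdcp_run_def real_fun_def)
  then have t1: "t 1 = F (x 1) - (F c + inner (f' c) (x 1 - c))"
    using iterate(5)[OF active_1] by (simp add: t_def m_def Psi_def)
  have t1_le: "t 1 \<le> 2 * M * r"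
    using linearization_error[OF x1 center] by (simp only: t1 r_def)
  have "r \<le> 4 * lam * M + R"
  proof (rule ccontr)
    assume "\<not> ?thesis"
    then have big: "r > 4 * lam * M + R" by simp
    have "0 < 4 * lam * M" using lam_pos M_pos by simp
    then have r_big: "0 < r" "R \<le> r" using big R0 by linarith+
    have "m 1 \<le> real_fun (G 1) xs + H xs + prox xs"
    proof -
      have "0 \<le> 1 / (2 * lam) * (norm (xs - x 1))\<^sup>2" using lam_pos by simp
      then show ?thesis using m_strong_min[OF active_1 xsD] by linarith
    qed
    also have "\<dots> \<le> F xs + H xs + prox xs"
      using model_le[OF model_G[OF active_1] xsD] by simp
    also have "\<dots> \<le> F (x 1) + H (x 1) + 1 / (2 * lam) * R\<^sup>2"
    proof -
      have "prox xs \<le> 1 / (2 * lam) * R\<^sup>2"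
        unfolding prox_def using R lam_pos by (intro mult_left_mono power_mono) auto
      then show ?thesis using minimizerD(2)[OF xs x1] by linarith
    qed
    finally have "prox (x 1) \<le> t 1 + 1 / (2 * lam) * R\<^sup>2"
      using iterate(5)[OF active_1] by (simp add: t_def Psi_def)
    then have "1 / (2 * lam) * r\<^sup>2 \<le> 2 * M * r + 1 / (2 * lam) * R\<^sup>2"
      using t1_le by (simp add: prox_def r_def)
    then have "r\<^sup>2 \<le> 4 * lam * M * r + R\<^sup>2"
      using lam_pos by (simp add: field_simps)
    moreover have "(4 * lam * M + R) * r < r * r"
      using big r_big by (intro mult_strict_right_mono)
    moreover have "R * R \<le> R * r"
      using R0 r_big by (intro mult_left_mono)
    ultimately show False by (simp add: power2_eq_square algebra_simps)
  qed
  then have "2 * M * r \<le> 2 * M * (4 * lam * M + R)" using M_pos by simp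
  then show ?thesis using t1_le by (simp add: power2_eq_square algebra_simps)
qed

text \<open>
  The recursion gives \<open>n\<^sup>2 * t n \<le> 4 * M * R + 16 * lam * M\<^sup>2 * n\<close>; beyond the stated \<open>n\<close>, each of the
  two terms is at most \<open>eps * n\<^sup>2 / 2\<close>.
\<close>

lemma unstopped_bound:
  assumes xs: "xs \<in> minimizers V (\<lambda>u. f u + h u)" and R: "norm (xs - c) \<le> R"
    and act: "active n" and gap: "\<not> gap n \<le> ereal eps"
  shows "real n < sqrt (8 * M * R / eps) + 32 * (lam * M\<^sup>2) / eps"
proof (rule ccontr)
  assume "\<not> ?thesis"
  then have n: "sqrt (8 * M * R / eps) + 32 * (lam * M\<^sup>2) / eps \<le> real n" by simp
  have R0: "R \<ge> 0" using R norm_ge_zero order_trans by blast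
  have n1: "real n \<ge> 1" using active_ge_1[OF act] by simp
  define L where "L = lam * M\<^sup>2"
  have L: "L \<ge> 0" using lam_pos by (simp add: L_def)
  have sq: "0 \<le> sqrt (8 * M * R / eps)" using R0 M_pos eps_pos by simp
  have n_large: "sqrt (8 * M * R / eps) \<le> real n" "32 * L / eps \<le> real n"
  proof -
    have "0 \<le> 32 * L / eps" using L eps_pos by simp
    then show "sqrt (8 * M * R / eps) \<le> real n" "32 * L / eps \<le> real n"
      using n sq unfolding L_def by linarith+
  qed
  have "8 * M * R / eps \<le> (real n)\<^sup>2"
    using n_large(1) sqrt_le_D by blast
  then have 1: "4 * M * R \<le> eps * (real n)\<^sup>2 / 2"
    using eps_pos by (simp add: field_simps)
  have "32 * L \<le> eps * real n" using n_large(2) eps_pos by (simp add: field_simps)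
  then have "32 * L * real n \<le> eps * real n * real n" using n1 by (intro mult_right_mono) auto
  then have 2: "16 * L * real n \<le> eps * (real n)\<^sup>2 / 2" by (simp add: power2_eq_square)
  have "real n * (real n + 1) * t n \<le> 2 * t 1 + 16 * L * (real n - 1)"
  proof (rule gap_recursion_bound[OF active_ge_1[OF act] L])
    fix j assume "1 \<le> j" "j < n"
    then show "t (j + 1) \<le> real j / (real j + 2) * t j + 8 * L / (real j * (real j + 2))"
      unfolding L_def using active_mono[OF act] by (intro gap_step) auto
  qed
  also have "\<dots> \<le> 4 * M * R + 16 * L * real n"
    using first_gap[OF xs R] by (simp add: L_def algebra_simps)
  also have "\<dots> \<le> eps * (real n)\<^sup>2" using 1 2 by simp
  finally have up: "real n * (real n + 1) * t n \<le> eps * (real n)\<^sup>2" .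
  have "eps < t n" using gap by (simp add: gap_eq[OF act])
  then have "real n * (real n + 1) * eps < real n * (real n + 1) * t n"
    using n1 by (intro mult_strict_left_mono) auto
  moreover have "0 \<le> real n * eps" using eps_pos by simp
  ultimately show False using up by (simp add: power2_eq_square algebra_simps)
qed

lemma stops_within:
  assumes xs: "xs \<in> minimizers V (\<lambda>u. f u + h u)" and R: "norm (xs - c) \<le> R"
  shows "pdcp_stops V f h lam eps c G y"
    and "real (pdcp_iters V f h lam eps c G y)
      \<le> sqrt (8 * M * R / eps) + 32 * (lam * M\<^sup>2) / eps + 1"
proof -
  let ?N = "sqrt (8 * M * R / eps) + 32 * (lam * M\<^sup>2) / eps"
  let ?P = "\<lambda>j. j \<ge> 1 \<and> gap j \<le> ereal eps"
  show stops: "pdcp_stops V f h lam eps c G y"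
  proof (rule ccontr)
    assume not: "\<not> ?thesis"
    obtain n where n: "?N < real n" using reals_Archimedean2 by blast
    have "active (n + 1)" "\<not> gap (n + 1) \<le> ereal eps"
      using not by (auto simp: pdcp_stops_def pdcp_active_def)
    from unstopped_bound[OF xs R this] n show False by simp
  qed
  define J where "J = pdcp_iters V f h lam eps c G y"
  have J: "?P J"
  proof -
    have "\<exists>j. ?P j" using stops by (auto simp: pdcp_stops_def)
    then show ?thesis unfolding J_def pdcp_iters_def by (rule LeastI_ex)
  qed
  have before: "\<not> ?P i" if "i < J" for i
    using not_less_Least that unfolding J_def pdcp_iters_def by blast
  have "real J \<le> ?N + 1"
  proof (cases "J = 1")
    case True
    have "R \<ge> 0" using R norm_ge_zero order_trans by blast
    then show ?thesis using True M_pos eps_pos lam_pos by simp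
  next
    case False
    then have "active (J - 1)" "\<not> gap (J - 1) \<le> ereal eps"
      using J before by (auto simp: pdcp_active_def)
    from unstopped_bound[OF xs R this] show ?thesis using J by simp
  qed
  then show "real (pdcp_iters V f h lam eps c G y) \<le> ?N + 1" by (simp add: J_def)
qed

text \<open>
  The two subgradient conditions on \<open>s J\<close> and the stopping test are the three clauses of the
  certificate; the second clause gains its quadratic term because \<open>x J\<close> minimizes
  the regularized \<open>h\<close> tilted by \<open>s J\<close>.
\<close>

lemma output_approx_prox_step:
  assumes stops: "pdcp_stops V f h lam eps c G y"
    and J: "J = pdcp_iters V f h lam eps c G y"
  shows "approx_prox_step lam eps c (x J) (y J) (s J)"
proof -
  have gap: "J \<ge> 1 \<and> gap J \<le> ereal eps"
  proof -
    have "\<exists>j. j \<ge> 1 \<and> gap j \<le> ereal eps" using stops by (auto simp: pdcp_stops_def)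
    then show ?thesis unfolding J pdcp_iters_def by (rule LeastI_ex)
  qed
  have "\<not> gap i \<le> ereal eps" if "i \<in> {1..<J}" for i
    using not_less_Least[of i "\<lambda>j. j \<ge> 1 \<and> gap j \<le> ereal eps"] that
    unfolding J pdcp_iters_def by auto
  with gap have act: "active J" by (simp add: pdcp_active_def)
  have xD: "x J \<in> D" by (rule x_in_D[OF act])
  have "ereal (real_fun (G J) (x J) + inner (s J) (u - x J)) \<le> f u" if u: "u \<in> V" for u
  proof -
    have "ereal (real_fun (G J) (x J) + inner (s J) (u - x J)) \<le> G J u"
      using iterate(2)[OF act] u model_eq[OF model_G[OF act] xD] by (simp add: subdiff_def)
    also have "\<dots> \<le> f u" using model_G[OF act] u by (simp add: is_model_def)
    finally show ?thesis .
  qed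
  moreover have "H (x J) + 1 / (2 * lam) * (norm (x J - c))\<^sup>2 + 1 / (2 * lam) * (norm (u - x J))\<^sup>2
              \<le> H u + inner (s J) (u - x J) + 1 / (2 * lam) * (norm (u - c))\<^sup>2"
    if u: "u \<in> D" for u
  proof -
    have "convex_on D (\<lambda>u. inner (s J) (u - x J))"
      by (rule convex_onI[OF _ convex_D]) (simp add: inner_diff_right inner_add_right algebra_simps)
    with convex_H have "convex_on D (\<lambda>u. H u + inner (s J) (u - x J))"
      by (rule convex_on_add)
    note three_point = prox_three_point[OF this xD u, of "1 / (2 * lam)" c]
    show ?thesis
    proof -
      have "H (x J) + 1 / (2 * lam) * (norm (x J - c))\<^sup>2
        \<le> H z + inner (s J) (z - x J) + 1 / (2 * lam) * (norm (z - c))\<^sup>2" if z: "z \<in> D" for z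
      proof -
        have "prox_reg h lam c (x J) + ereal (inner (- s J) (z - x J)) \<le> prox_reg h lam c z"
          using iterate(3)[OF act] D_in_V[OF z] by (simp add: subdiff_def)
        then show ?thesis by (simp add: prox_reg_eq[OF z] prox_reg_eq[OF xD])
      qed
      then show ?thesis
        using three_point by simp
    qed
  qed
  moreover have "F (y J) + H (y J) + 1 / (2 * lam) * (norm (y J - c))\<^sup>2
        \<le> real_fun (G J) (x J) + H (x J) + 1 / (2 * lam) * (norm (x J - c))\<^sup>2 + eps"
    using gap gap_eq[OF act] by (simp add: t_def m_def Psi_def prox_def)
  ultimately show ?thesis
    unfolding approx_prox_step_def using xD y_step(1)[OF act] by blast
qed

end

section \<open>The outer loop\<close>

context composite
begin

lemma sol_dist_nonneg: "0 \<le> sol_dist V f h x0"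
  unfolding sol_dist_def using problem by (intro cInf_greatest) (auto simp: problem_def)

text \<open>
  Minimizers at distance less than \<open>d0 + e\<close> take the place of a nearest one, so that no compactness
  argument is called for; the estimates survive the limit \<open>e \<rightarrow> 0\<close>.
\<close>

lemma near_minimizer:
  assumes "e > 0"
  obtains xs where "xs \<in> minimizers V (\<lambda>u. f u + h u)" "norm (xs - x0) < sol_dist V f h x0 + e"
proof -
  let ?S = "(\<lambda>x. norm (x - x0)) ` minimizers V (\<lambda>u. f u + h u)"
  have "?S \<noteq> {}" using problem by (auto simp: problem_def)
  moreover have "Inf ?S < sol_dist V f h x0 + e" using assms by (simp add: sol_dist_def)
  ultimately have "\<exists>r\<in>?S. r < sol_dist V f h x0 + e" by (intro cInf_lessD) auto
  then show thesis using that by auto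
qed

text \<open>
  Over \<open>k\<close> steps the squared distance to the minimizer grows by at most \<open>8 * d0\<^sup>2\<close>, from about
  \<open>d0\<^sup>2\<close> to about \<open>(3 * d0)\<^sup>2\<close>.
\<close>

lemma prox_chain_stays_close:
  assumes steps: "\<And>i. i \<in> {1..k} \<Longrightarrow> approx_prox_step lam eps (c (i - 1)) (c i) (p i) (q i)"
    and lam: "lam > 0" and d0: "d0 = sol_dist V f h (c 0)"
    and total: "real k * (lam * eps) \<le> 4 * d0\<^sup>2" and e: "e > 0"
  obtains xs where "xs \<in> minimizers V (\<lambda>u. f u + h u)"
    "norm (xs - c 0) \<le> d0 + e" "norm (xs - c k) \<le> 3 * d0 + e"
proof -
  obtain xs where xs: "xs \<in> minimizers V (\<lambda>u. f u + h u)" and near: "norm (xs - c 0) < d0 + e"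
    using near_minimizer[OF e] d0 by blast
  have d0_nonneg: "0 \<le> d0" using sol_dist_nonneg d0 by simp
  have "(norm (xs - c k))\<^sup>2 \<le> (norm (xs - c 0))\<^sup>2 + 2 * (real k * (lam * eps))"
    using steps lam xs by (rule prox_chain_distance)
  also have "\<dots> \<le> (d0 + e)\<^sup>2 + 8 * d0\<^sup>2"
    using power_mono[of "norm (xs - c 0)" "d0 + e" 2] near total by simp
  also have "\<dots> \<le> (3 * d0 + e)\<^sup>2"
    using d0_nonneg e by (simp add: power2_eq_square algebra_simps)
  finally have "norm (xs - c k) \<le> 3 * d0 + e"
    using d0_nonneg e by (intro power2_le_imp_le[of "norm (xs - c k)"]) auto
  with xs near show thesis using that by simp
qed

text \<open>
  The radius is \<open>6 * d0 = 2 * d0 + 3 * d0 + d0\<close>: from \<open>p k\<close> to the center \<open>c k\<close>, on to a minimizer, and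
  from there to \<open>c 0\<close>. The last two distances are only known up to \<open>e / 2\<close>, hence the limit.
\<close>

lemma prox_chain_in_ball:
  assumes steps: "\<And>i. i \<in> {1..k} \<Longrightarrow> approx_prox_step lam eps (c (i - 1)) (c i) (p i) (q i)"
    and lam: "lam > 0" and d0: "d0 = sol_dist V f h (c 0)" and k: "k \<ge> 1"
    and total: "real k * (lam * eps) \<le> 4 * d0\<^sup>2" and le: "lam * eps \<le> 2 * d0\<^sup>2"
  shows "p k \<in> cball (c 0) (6 * d0)"
proof -
  have d0_nonneg: "0 \<le> d0" using sol_dist_nonneg d0 by simp
  have "(norm (p k - c k))\<^sup>2 \<le> 2 * (lam * eps)"
    using approx_prox_step_distance(2)[OF steps[of k] lam] k by simp
  also have "\<dots> \<le> 2 * (2 * d0\<^sup>2)" using le by (intro mult_left_mono) auto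
  also have "\<dots> = (2 * d0)\<^sup>2" by (simp add: power_mult_distrib)
  finally have p: "norm (p k - c k) \<le> 2 * d0"
    using d0_nonneg by (intro power2_le_imp_le[of "norm (p k - c k)"]) auto
  have "norm (p k - c 0) \<le> 6 * d0"
  proof (rule field_le_epsilon)
    fix e :: real assume "e > 0"
    then have "e / 2 > 0" by simp
    from prox_chain_stays_close[OF steps lam d0 total this]
    obtain xs where "norm (xs - c 0) \<le> d0 + e / 2" "norm (xs - c k) \<le> 3 * d0 + e / 2" by blast
    moreover have "norm (p k - c 0) \<le> norm (p k - c k) + norm (xs - c k) + norm (xs - c 0)"
      using norm_triangle_ineq[of "(p k - c k) - (xs - c k)" "xs - c 0"]
        norm_triangle_ineq4[of "p k - c k" "xs - c k"] by simp
    ultimately show "norm (p k - c 0) \<le> 6 * d0 + e" using p by linarith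
  qed
  then show ?thesis by (simp add: dist_norm norm_minus_commute)
qed

text \<open>
  Termination and localization must be proved together: the \<open>k\<close>-th call is constrained only if
  the earlier ones stop, and its iteration bound needs its center to be close to a minimizer,
  which follows from the proximal steps made before.
\<close>

lemma pdpb_calls_stop:
  assumes lam: "lam > 0" and eps: "eps > 0" and x0: "x0 \<in> D" and d0: "d0 = sol_dist V f h x0"
    and le: "lam * eps \<le> 2 * d0\<^sup>2"
    and tau: "\<forall>k\<ge>1. \<forall>j\<ge>1. tau k j = real j / (real j + 2)"
    and run: "pdpb_run V f h f' lam eps x0 tau c G x y s"
    and J: "J = pdpb_iters V f h lam eps c G y"
    and total: "real k * (lam * eps) \<le> 4 * d0\<^sup>2" and k: "k \<ge> 1"
  shows "pdcp_stops V f h lam eps (c (k - 1)) (G k) (y k) \<and>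
    approx_prox_step lam eps (c (k - 1)) (c k) (y k (J k)) (s k (J k)) \<and>
    real (J k) \<le> sqrt (32 * (M * d0 / eps)) + 32 * (lam * M\<^sup>2) / eps + 1"
  using k total
proof (induction k rule: less_induct)
  case (less k)
  have c0: "c 0 = x0" using run by (simp add: pdpb_run_def)
  have d0_nonneg: "0 \<le> d0" using sol_dist_nonneg d0 by simp
  have total_i: "real i * (lam * eps) \<le> 4 * d0\<^sup>2" if "i \<le> k" for i
  proof -
    have "real i * (lam * eps) \<le> real k * (lam * eps)"
      using that lam eps by (intro mult_right_mono) auto
    then show ?thesis using less.prems(2) by linarith
  qed
  have IH: "pdcp_stops V f h lam eps (c (i - 1)) (G i) (y i)"
    "approx_prox_step lam eps (c (i - 1)) (c i) (y i (J i)) (s i (J i))"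
    if "1 \<le> i" "i < k" for i
    using less.IH[OF that(2,1) total_i] that by auto
  have call: "pdcp_run V f h f' lam eps (c (k - 1)) (tau k) (G k) (x k) (y k) (s k)"
    "pdcp_stops V f h lam eps (c (k - 1)) (G k) (y k) \<Longrightarrow> c k = x k (J k)"
    using run less.prems(1) IH(1) unfolding pdpb_run_def J pdpb_iters_def by auto
  have steps: "approx_prox_step lam eps (c (i - 1)) (c i) (y i (J i)) (s i (J i))"
    if "i \<in> {1..k - 1}" for i
    using IH(2)[of i] that less.prems(1) by auto
  have center: "c (k - 1) \<in> D"
  proof (cases "k = 1")
    case False
    then have "approx_prox_step lam eps (c (k - 1 - 1)) (c (k - 1)) (y (k - 1) (J (k - 1))) (s (k - 1) (J (k - 1)))"
      using less.prems(1) by (intro steps) auto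
    then show ?thesis by (simp add: approx_prox_step_def)
  qed (simp add: c0 x0)
  interpret pdcp_call V f h f' M lam eps "c (k - 1)" "tau k" "G k" "x k" "y k" "s k"
    using lam eps center call(1) tau less.prems(1) by unfold_locales auto
  have "d0 > 0"
  proof -
    have "0 < lam * eps" using lam eps by simp
    then have "d0 \<noteq> 0" using le by auto
    then show ?thesis using d0_nonneg by simp
  qed
  then obtain xs where xs: "xs \<in> minimizers V (\<lambda>u. f u + h u)"
    and "norm (xs - c (k - 1)) \<le> 3 * d0 + d0"
    using prox_chain_stays_close[where k = "k - 1" and e = d0,
        OF steps lam d0[folded c0] total_i[of "k - 1"]] by auto
  then have near: "norm (xs - c (k - 1)) \<le> 4 * d0" by simp
  have stops: "pdcp_stops V f h lam eps (c (k - 1)) (G k) (y k)"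
    by (rule stops_within(1)[OF xs near])
  have "J k = pdcp_iters V f h lam eps (c (k - 1)) (G k) (y k)"
    by (simp add: J pdpb_iters_def)
  moreover have "8 * M * (4 * d0) / eps = 32 * (M * d0 / eps)" by simp
  ultimately show ?case
    using output_approx_prox_step[OF stops] stops_within(2)[OF xs near] call(2)[OF stops] stops
    by metis
qed

text \<open>
  The lower bound on \<open>lam\<close> is exactly \<open>d0\<^sup>2 / eps \<le> lam * w ^ 3\<close> with \<open>w\<^sup>2 = M * d0 / eps\<close>, so
  \<open>K \<le> 4 * w ^ 3\<close>. It is used for the square root and for the constant term; the middle term
  cancels \<open>lam\<close>. The three contributions add up to
  \<open>24 * w ^ 4 + 128 * w ^ 4 + (4 + 4 * w ^ 4)\<close>.
\<close>

lemma iteration_count_arith: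
  fixes K :: real
  assumes lam: "lam > 0" and eps: "eps > 0" and d0: "d0 > 0"
    and lower: "sqrt (eps * d0) / M powr (3 / 2) \<le> lam"
    and K: "K \<ge> 0" "K * (lam * eps) \<le> 4 * d0\<^sup>2"
  shows "K * (sqrt (32 * (M * d0 / eps)) + 32 * (lam * M\<^sup>2) / eps + 1)
    \<le> 160 * (M\<^sup>2 * d0\<^sup>2 / eps\<^sup>2 + 1)"
proof -
  define w where "w = sqrt (M * d0 / eps)"
  have w0: "w > 0" using M_pos d0 eps by (simp add: w_def)
  have w2: "w\<^sup>2 = M * d0 / eps" using M_pos d0 eps by (simp add: w_def)
  have w4: "w ^ 4 = M\<^sup>2 * d0\<^sup>2 / eps\<^sup>2"
    using arg_cong[OF w2, of "\<lambda>z. z\<^sup>2"] by (simp add: power_mult_distrib power_divide flip: power_mult)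
  have M32: "M powr (3 / 2) = M * sqrt M"
  proof -
    have "M powr (3 / 2) = M powr (1 + 1 / 2)" by simp
    also have "\<dots> = M powr 1 * M powr (1 / 2)" by (rule powr_add)
    finally show ?thesis using M_pos by (simp add: powr_half_sqrt)
  qed
  have "sqrt (eps * d0) / (M * sqrt M) * w ^ 3 = d0\<^sup>2 / eps"
  proof -
    have "sqrt (eps * d0) * w = d0 * sqrt M"
      using eps d0 M_pos by (simp add: w_def real_sqrt_mult real_sqrt_divide)
    then have "sqrt (eps * d0) / (M * sqrt M) * w ^ 3 = d0 * sqrt M * w\<^sup>2 / (M * sqrt M)"
      by (simp add: power3_eq_cube power2_eq_square flip: mult.assoc)
    also have "\<dots> = d0\<^sup>2 / eps"
      using M_pos eps unfolding w2 by (simp add: power2_eq_square)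
    finally show ?thesis .
  qed
  then have lam_w: "d0\<^sup>2 / eps \<le> lam * w ^ 3"
    using mult_right_mono[OF lower, of "w ^ 3"] w0 by (simp add: M32)
  have K3: "K \<le> 4 * w ^ 3"
  proof -
    have "K * lam \<le> 4 * (d0\<^sup>2 / eps)" using K(2) eps by (simp add: field_simps)
    also have "\<dots> \<le> 4 * w ^ 3 * lam" using lam_w by (simp add: mult.commute)
    finally show ?thesis using lam by simp
  qed
  have 1: "K * sqrt (32 * (M * d0 / eps)) \<le> 24 * w ^ 4"
  proof -
    have "sqrt 32 \<le> (6 :: real)" by (rule real_le_lsqrt) auto
    then have "K * (sqrt 32 * w) \<le> 4 * w ^ 3 * (6 * w)"
      using K3 K(1) w0 by (intro mult_mono) auto
    also have "\<dots> = 24 * w ^ 4" by (simp add: power3_eq_cube power4_eq_xxxx)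
    also have "sqrt 32 * w = sqrt (32 * (M * d0 / eps))"
      unfolding w_def by (simp only: real_sqrt_mult)
    finally show ?thesis .
  qed
  have 2: "K * (32 * (lam * M\<^sup>2) / eps) \<le> 128 * w ^ 4"
  proof -
    have "K * (32 * (lam * M\<^sup>2) / eps) = K * (lam * eps) * (32 * M\<^sup>2 / eps\<^sup>2)"
      using eps by (simp add: power2_eq_square)
    also have "\<dots> \<le> 4 * d0\<^sup>2 * (32 * M\<^sup>2 / eps\<^sup>2)"
      using K(2) by (intro mult_right_mono) auto
    also have "\<dots> = 128 * w ^ 4" unfolding w4 by simp
    finally show ?thesis .
  qed
  have 3: "K \<le> 4 + 4 * w ^ 4"
  proof -
    have "w ^ 3 \<le> 1 + w ^ 4"
    proof (cases "w \<le> 1")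
      case True
      then have "w ^ 3 \<le> 1" using w0 by (intro power_le_one) auto
      moreover have "0 \<le> w ^ 4" using w0 by simp
      ultimately show ?thesis by linarith
    next
      case False
      then have "w ^ 3 \<le> w ^ 4" by (intro power_increasing) auto
      then show ?thesis by linarith
    qed
    then show ?thesis using K3 by linarith
  qed
  have "K * (sqrt (32 * (M * d0 / eps)) + 32 * (lam * M\<^sup>2) / eps + 1)
      \<le> 24 * w ^ 4 + 128 * w ^ 4 + (4 + 4 * w ^ 4)"
    unfolding distrib_left using 1 2 3 by simp
  also have "\<dots> \<le> 160 * (w ^ 4 + 1)" using w0 by simp
  finally show ?thesis by (simp only: w4)
qed

text \<open>
  After \<open>K\<close> calls the criterion holds, so the first \<open>k\<close> at which it holds is at most \<open>K\<close>, and each of these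
  calls obeys the iteration bound.
\<close>

theorem pdpb_complexity:
  assumes x0: "x0 \<in> D" and eps: "eps > 0" and lam: "lam > 0" and d0: "d0 = sol_dist V f h x0"
    and lower: "sqrt (eps * d0) / M powr (3 / 2) \<le> lam" and upper: "lam \<le> 2 * d0\<^sup>2 / eps"
    and tau: "\<forall>k\<ge>1. \<forall>j\<ge>1. tau k j = real j / (real j + 2)"
    and run: "pdpb_run V f h f' lam eps x0 tau c G x y s"
    and J: "J = pdpb_iters V f h lam eps c G y"
    and crit: "crit = (\<lambda>k. pd_gap V f h (cball x0 (6 * d0)) (output_avg J y k) (output_avg J s k)
                    \<le> ereal (10 * eps))"
  shows "\<exists>k\<ge>1. (\<forall>i\<in>{1..k}. pdcp_stops V f h lam eps (c (i - 1)) (G i) (y i)) \<and>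
     crit k \<and> (\<forall>i\<in>{1..<k}. \<not> crit i) \<and>
     real (\<Sum>i=1..k. J i) \<le> 160 * (M\<^sup>2 * d0\<^sup>2 / eps\<^sup>2 + 1)"
proof -
  have c0: "c 0 = x0" using run by (simp add: pdpb_run_def)
  have le: "lam * eps \<le> 2 * d0\<^sup>2" using upper eps by (simp add: field_simps)
  have pos: "0 < lam * eps" using lam eps by simp
  have d0_pos: "d0 > 0"
  proof -
    have "d0 \<noteq> 0" using le pos by auto
    then show ?thesis using sol_dist_nonneg[of x0] d0 by simp
  qed
  \<comment> \<open>With \<open>k \<ge> a\<close> the gap bound is \<open>eps + 18 * d0\<^sup>2 / (lam * k) \<le> 10 * eps\<close>. As \<open>a \<ge> 1\<close>, rounding
    up at most doubles the number of calls.\<close>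
  define a where "a = 2 * d0\<^sup>2 / (lam * eps)"
  define K where "K = nat \<lceil>a\<rceil>"
  have one: "1 \<le> a" using le pos by (simp add: a_def)
  have K_lower: "a \<le> real K"
    unfolding K_def by (rule real_nat_ceiling_ge)
  then have K1: "K \<ge> 1" using one by linarith
  have "real K \<le> 2 * a"
    unfolding K_def using one by linarith
  also have "\<dots> = 4 * d0\<^sup>2 / (lam * eps)" by (simp add: a_def)
  finally have K_upper: "real K * (lam * eps) \<le> 4 * d0\<^sup>2"
    using pos by (simp only: pos_le_divide_eq)
  have upto: "real k * (lam * eps) \<le> 4 * d0\<^sup>2" if "k \<le> K" for k
  proof -
    have "real k * (lam * eps) \<le> real K * (lam * eps)"
      using that pos by (intro mult_right_mono) auto
    then show ?thesis using K_upper by linarith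
  qed
  let ?N = "sqrt (32 * (M * d0 / eps)) + 32 * (lam * M\<^sup>2) / eps + 1"
  have calls: "pdcp_stops V f h lam eps (c (i - 1)) (G i) (y i)"
    "approx_prox_step lam eps (c (i - 1)) (c i) (y i (J i)) (s i (J i))"
    "real (J i) \<le> ?N" if "i \<in> {1..K}" for i
    using pdpb_calls_stop[OF lam eps x0 d0 le tau run J upto, of i] that by auto
  have ball: "y i (J i) \<in> cball (c 0) (6 * d0)" if i: "i \<in> {1..K}" for i
  proof (rule prox_chain_in_ball[where p = "\<lambda>i. y i (J i)" and q = "\<lambda>i. s i (J i)"])
    show "approx_prox_step lam eps (c (j - 1)) (c j) (y j (J j)) (s j (J j))" if "j \<in> {1..i}" for j
      using that i by (intro calls(2)) auto
  qed (use lam d0 c0 le i upto[of i] in auto)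
  have "pd_gap V f h (cball (c 0) (6 * d0)) (output_avg J y K) (output_avg J s K)
      \<le> ereal (eps + (6 * d0)\<^sup>2 / (2 * lam * real K))"
    unfolding output_avg_def
    using d0_pos by (intro prox_chain_gap calls(2) ball lam K1) auto
  also have "\<dots> \<le> ereal (10 * eps)"
  proof -
    have "2 * d0\<^sup>2 \<le> eps * (lam * real K)"
      using K_lower pos by (simp add: a_def field_simps)
    moreover have "0 < lam * real K" using lam K1 by simp
    ultimately have "(6 * d0)\<^sup>2 / (2 * lam * real K) \<le> 9 * eps"
      by (simp add: power2_eq_square field_simps)
    then show ?thesis by simp
  qed
  finally have critK: "crit K" by (simp add: crit c0)
  define k where "k = (LEAST k. k \<ge> 1 \<and> crit k)"
  have k: "k \<ge> 1 \<and> crit k" unfolding k_def by (rule LeastI[of _ K]) (use K1 critK in auto)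
  have kK: "k \<le> K" unfolding k_def by (rule Least_le) (use K1 critK in auto)
  have first: "\<not> crit i" if "i \<in> {1..<k}" for i
    using not_less_Least[of i "\<lambda>k. k \<ge> 1 \<and> crit k"] that unfolding k_def by auto
  have "real (\<Sum>i=1..k. J i) = (\<Sum>i=1..k. real (J i))" by simp
  also have "\<dots> \<le> (\<Sum>i=1..k. ?N)" using calls(3) kK by (intro sum_mono) auto
  also have "\<dots> = real k * ?N" by simp
  also have "\<dots> \<le> 160 * (M\<^sup>2 * d0\<^sup>2 / eps\<^sup>2 + 1)"
    by (rule iteration_count_arith[OF lam eps d0_pos lower _ upto[OF kK]]) simp
  finally show ?thesis using k first calls(1) kK by (intro exI[of _ k]) auto
qed

end

theorem theorem2p1:
  shows "\<exists>C::real. C > 0 \<and>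
    (\<forall>(n::nat) (f :: fsseq \<Rightarrow> ereal) (h :: fsseq \<Rightarrow> ereal) (f' :: fsseq \<Rightarrow> fsseq) (M::real)
      (x0::fsseq) (eps::real) (lam::real) (d0::real) (tau :: nat \<Rightarrow> nat \<Rightarrow> real)
      (c :: nat \<Rightarrow> fsseq) (G :: nat \<Rightarrow> nat \<Rightarrow> fsseq \<Rightarrow> ereal)
      (x :: nat \<Rightarrow> nat \<Rightarrow> fsseq) (y :: nat \<Rightarrow> nat \<Rightarrow> fsseq) (s :: nat \<Rightarrow> nat \<Rightarrow> fsseq) J crit.
      problem (Rn n) f h f' M \<longrightarrow>
      x0 \<in> edom (Rn n) h \<longrightarrow>
      eps > 0 \<longrightarrow> lam > 0 \<longrightarrow>
      d0 = sol_dist (Rn n) f h x0 \<longrightarrow>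
      sqrt (eps * d0) / M powr (3 / 2) \<le> lam \<longrightarrow>
      lam \<le> 2 * d0\<^sup>2 / eps \<longrightarrow>
      (\<forall>k\<ge>1. \<forall>j\<ge>1. tau k j = real j / (real j + 2)) \<longrightarrow>
      pdpb_run (Rn n) f h f' lam eps x0 tau c G x y s \<longrightarrow>
      J = pdpb_iters (Rn n) f h lam eps c G y \<longrightarrow>
      crit = (\<lambda>k. pd_gap (Rn n) f h (cball x0 (6 * d0)) (output_avg J y k) (output_avg J s k)
                    \<le> ereal (10 * eps)) \<longrightarrow>
      (\<exists>k\<ge>1. (\<forall>i\<in>{1..k}. pdcp_stops (Rn n) f h lam eps (c (i - 1)) (G i) (y i)) \<and>
             crit k \<and> (\<forall>i\<in>{1..<k}. \<not> crit i) \<and>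
             real (\<Sum>i=1..k. J i) \<le> C * (M\<^sup>2 * d0\<^sup>2 / eps\<^sup>2 + 1)))"
proof (rule exI[of _ 160], intro conjI allI impI)
  fix n :: nat and f h :: "fsseq \<Rightarrow> ereal" and f' :: "fsseq \<Rightarrow> fsseq" and M :: real
  assume "problem (Rn n) f h f' M"
  then interpret composite "Rn n" f h f' M
    by unfold_locales (simp_all add: subspace_imp_convex subspace_Rn)
  fix x0 eps lam d0 tau c G x y s J crit
  assume "x0 \<in> edom (Rn n) h" "eps > 0" "lam > 0" "d0 = sol_dist (Rn n) f h x0"
    "sqrt (eps * d0) / M powr (3 / 2) \<le> lam" "lam \<le> 2 * d0\<^sup>2 / eps"
    "\<forall>k\<ge>1. \<forall>j\<ge>1. tau k j = real j / (real j + 2)"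
    "pdpb_run (Rn n) f h f' lam eps x0 tau c G x y s"
    "J = pdpb_iters (Rn n) f h lam eps c G y"
    "crit = (\<lambda>k. pd_gap (Rn n) f h (cball x0 (6 * d0)) (output_avg J y k) (output_avg J s k)
                    \<le> ereal (10 * eps))"
  then show "\<exists>k\<ge>1. (\<forall>i\<in>{1..k}. pdcp_stops (Rn n) f h lam eps (c (i - 1)) (G i) (y i)) \<and>
             crit k \<and> (\<forall>i\<in>{1..<k}. \<not> crit i) \<and>
             real (\<Sum>i=1..k. J i) \<le> 160 * (M\<^sup>2 * d0\<^sup>2 / eps\<^sup>2 + 1)"
    by (rule pdpb_complexity)
qed simp

end
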